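(* Let $v$ be an archimedean place and $d\ge1$. Consider $(\mathbb{P}^d(\mathbb{C}_v),\mathcal{O}(1))$ with the Fubini--Study metric $$|s([x_0:\dots:x_d])|_{L,v}=\frac{|s(x_0,\dots,x_d)|_v}{\sqrt{|x_0|_v^2+\dots+|x_d|_v^2}}.$$ Let $x=[x_0:\dots:x_d]\in\mathbb{P}^d(\mathbb{C}_v)$. Let $Y_1,\dots,Y_{d+1}$ be a linear basis of the space $\mathbb{C}_v[X_0,\dots,X_d]_1$ of linear forms such that $Y_1,\dots,Y_d$ span the space of linear forms vanishing at $(x_0,\dots,x_d)$. Let $t_j=Y_j/Y_{d+1}$ for $1\le j\le d$ (a system of local parameters at $x$) and $\sigma=Y_{d+1}$ (a local trivialization of $L=\mathcal{O}(1)$ around $x$). Let $U_1,\dots,U_{d+1}$ be the orthonormal basis obtained by applying the Gram--Schmidt orthonormalization process to $Y_1,\dots,Y_{d+1}$, and set $\gamma_j=\langle Y_j\,|\,U_j\rangle^{-1}>0$ for $1\le j\le d+1$. Then the local Chebyshev transform of the Fubini--Study metric is given by $$c_{L,v}^{x,\sigma,t}(\alpha)=\sum_{j=1}^{d+1}\alpha_j\log(\gamma_j)+\frac12h_d(\alpha)$$ on the Okounkov body $$\Delta_{x,t}(L)=\{\alpha\in\mathbb{R}_{\ge0}^d:\ \alpha_1+\dots+\alpha_d\le1\},$$ where $\alpha_{d+1}=1-\sum_{j=1}^d\alpha_j$ and $h_d$ is the entropy functional $h_d(\alpha)=\sum_{j=1}^{d+1}\alpha_j\log\big(\frac1{\a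lpha_j}\big)$.
   Context: Here $\mathbb{C}_v=\mathbb{C}$. The hermitian inner product $\langle\cdot|\cdot\rangle$ on linear forms is the standard one, for which $X_0,\dots,X_d$ is orthonormal. $H^0(\mathbb{P}^d,\mathcal{O}(n))_v=\mathbb{C}[X_0,\dots,X_d]_n$, with $\|s\|_{L^{\otimes n},v}=\sup|s(x_0,\dots,x_d)|/(|x_0|^2+\dots+|x_d|^2)^{n/2}$. For a nonzero section $s$ write $s=\big(\sum_{m\in\mathbb{N}^d}a_mt^m\big)\sigma^{\otimes n}$ near $x$, let $\mathrm{ord}_{x,t}(s)=\min\{m:a_m\ne0\}$ for the lexicographic order, and $\mathrm{lead}_{x,\sigma^{\otimes n},t}(s)=a_{\mathrm{ord}_{x,t}(s)}$. Put $$F_{L^{\otimes n},v}^{x,\sigma^{\otimes n},t}(m)=\sup_{\mathrm{ord}_{x,t}(s)=m}\frac{|\mathrm{lead}_{x,\sigma^{\otimes n},t}(s)|_v}{\|s\|_{L^{\otimes n},v}}.$$ The Okounkov body $\Delta_{x,t}(L)$ is the closure of $\bigcup_{n\ge1}\frac1n\mathrm{ord}_{x,t}(H^0(\mathbb{P}^d,\mathcal{O}(n))_v\setminus\{0\})$, and $c_{L,v}^{x,\sigma,t}(\alpha)=\lim_{n\to\infty}\frac1n\log F_{L^{\otimes n},v}^{x,\sigma^{\otimes n},t}(m_n)$ where $m_n$ is the order of some nonzero section of $\mathcal{O}(n)$ and $m_n/n\to\alpha$; the limit is well defined for $\alpha$ in the interior of $\Delta_{x,t}(L)$ (Yuan),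 with boundary values understood by continuous extension. Convention: $0\log(1/0)=0$. *)

theory Defs
  imports "HOL-Analysis.Analysis" "HOL-Library.Poly_Mapping"
begin

text \<open>
  Polynomials in \<open>X\<^sub>0, X\<^sub>1, \<dots>\<close> over the complex numbers are finitely supported functions from
  exponent vectors to coefficients.  All index sets start at \<open>0\<close>: coordinates \<open>X\<^sub>i\<close> have
  \<open>i \<le> d\<close>, the basis of linear forms is \<open>Y 0, \<dots>, Y d\<close> (so \<open>Y d\<close> is the form not vanishing
  at \<open>x\<close>), and local parameters, exponents of their monomials and points of \<open>\<real>\<^sup>d\<close> have
  indices \<open>j < d\<close>.
\<close>

abbreviation "lookup \<equiv> Poly_Mapping.lookup"
abbreviation "keys \<equiv> Poly_Mapping.keys"

type_synonym mpol = "(nat \<Rightarrow>\<^sub>0 nat) \<Rightarrow>\<^sub>0 complex"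

definition pscale :: "complex \<Rightarrow> mpol \<Rightarrow> mpol" where
  "pscale c p = Poly_Mapping.map ((*) c) p"

lemma lookup_pscale: "lookup (pscale c p) m = c * lookup p m"
  by (simp add: pscale_def Poly_Mapping.map.rep_eq when_def)

interpretation mpol: vector_space pscale
  by unfold_locales (auto intro!: poly_mapping_eqI simp: lookup_pscale lookup_add algebra_simps)

definition peval :: "mpol \<Rightarrow> (nat \<Rightarrow> complex) \<Rightarrow> complex" where
  "peval p y = (\<Sum>m\<in>keys p. lookup p m * (\<Prod>i\<in>keys m. y i ^ lookup m i))"

text \<open>\<open>H\<^sup>0(\<PP>\<^sup>d, \<O>(n))\<close>, the homogeneous polynomials of degree \<open>n\<close> in \<open>X\<^sub>0, \<dots>, X\<^sub>d\<close>.\<close>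

definition sections :: "nat \<Rightarrow> nat \<Rightarrow> mpol set" where
  "sections d n = {p. \<forall>m\<in>keys p. keys m \<subseteq> {..d} \<and> (\<Sum>i\<in>keys m. lookup m i) = n}"

definition proj_coords :: "nat \<Rightarrow> (nat \<Rightarrow> complex) set" where
  "proj_coords d = {y. \<exists>i\<le>d. y i \<noteq> 0}"

definition fs_metric :: "nat \<Rightarrow> nat \<Rightarrow> mpol \<Rightarrow> (nat \<Rightarrow> complex) \<Rightarrow> real" where
  "fs_metric d n s y = cmod (peval s y) / sqrt (\<Sum>i\<le>d. (cmod (y i))\<^sup>2) ^ n"

definition fs_sup_norm :: "nat \<Rightarrow> nat \<Rightarrow> mpol \<Rightarrow> real" where
  "fs_sup_norm d n s = (SUP y\<in>proj_coords d. fs_metric d n s y)"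

text \<open>
  \<open>a\<close> is the family of coefficients in \<open>s = (\<Sum>m. a\<^sub>m t\<^sup>m) \<sigma>\<^sup>n\<close> near \<open>x\<close>.  The local parameters are
  given as functions of homogeneous coordinates; as \<open>t\<^sub>j\<close> and \<open>s / \<sigma>\<^sup>n\<close> are invariant under
  scaling, a neighbourhood of the coordinate vector \<open>x\<close> amounts to one of the point
  \<open>[x\<^sub>0 : \<dots> : x\<^sub>d]\<close>.
\<close>

definition is_expansion ::
  "nat \<Rightarrow> (nat \<Rightarrow> complex) \<Rightarrow> mpol \<Rightarrow> (nat \<Rightarrow> (nat \<Rightarrow> complex) \<Rightarrow> complex) \<Rightarrow> nat \<Rightarrow> mpol \<Rightarrow>
    ((nat \<Rightarrow>\<^sub>0 nat) \<Rightarrow> complex) \<Rightarrow> bool" where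
  "is_expansion d x \<sigma> t n s a \<longleftrightarrow>
     (\<forall>m. \<not> keys m \<subseteq> {..<d} \<longrightarrow> a m = 0) \<and>
     (\<forall>\<^sub>F y in nhds x.
        ((\<lambda>m. a m * (\<Prod>j<d. t j y ^ lookup m j)) has_sum (peval s y / peval \<sigma> y ^ n))
          {m. keys m \<subseteq> {..<d}})"

definition expansion ::
  "nat \<Rightarrow> (nat \<Rightarrow> complex) \<Rightarrow> mpol \<Rightarrow> (nat \<Rightarrow> (nat \<Rightarrow> complex) \<Rightarrow> complex) \<Rightarrow> nat \<Rightarrow> mpol \<Rightarrow>
    (nat \<Rightarrow>\<^sub>0 nat) \<Rightarrow> complex" where
  "expansion d x \<sigma> t n s = (THE a. is_expansion d x \<sigma> t n s a)"

text \<open>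
  The order on \<^typ>\<open>nat \<Rightarrow>\<^sub>0 nat\<close> is the lexicographic one, the coordinate of index \<open>0\<close> being
  the most significant; it is a well-order on vectors supported in \<open>{..<d}\<close>.
\<close>

definition ord_sec ::
  "nat \<Rightarrow> (nat \<Rightarrow> complex) \<Rightarrow> mpol \<Rightarrow> (nat \<Rightarrow> (nat \<Rightarrow> complex) \<Rightarrow> complex) \<Rightarrow> nat \<Rightarrow> mpol \<Rightarrow>
    (nat \<Rightarrow>\<^sub>0 nat)" where
  "ord_sec d x \<sigma> t n s = (LEAST m. expansion d x \<sigma> t n s m \<noteq> 0)"

definition lead_sec ::
  "nat \<Rightarrow> (nat \<Rightarrow> complex) \<Rightarrow> mpol \<Rightarrow> (nat \<Rightarrow> (nat \<Rightarrow> complex) \<Rightarrow> complex) \<Rightarrow> nat \<Rightarrow> mpol \<Rightarrow>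
    complex" where
  "lead_sec d x \<sigma> t n s = expansion d x \<sigma> t n s (ord_sec d x \<sigma> t n s)"

definition ord_set ::
  "nat \<Rightarrow> (nat \<Rightarrow> complex) \<Rightarrow> mpol \<Rightarrow> (nat \<Rightarrow> (nat \<Rightarrow> complex) \<Rightarrow> complex) \<Rightarrow> nat \<Rightarrow>
    (nat \<Rightarrow>\<^sub>0 nat) set" where
  "ord_set d x \<sigma> t n = ord_sec d x \<sigma> t n ` (sections d n - {0})"

definition lead_sup ::
  "nat \<Rightarrow> (nat \<Rightarrow> complex) \<Rightarrow> mpol \<Rightarrow> (nat \<Rightarrow> (nat \<Rightarrow> complex) \<Rightarrow> complex) \<Rightarrow> nat \<Rightarrow>
    (nat \<Rightarrow>\<^sub>0 nat) \<Rightarrow> real" where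
  "lead_sup d x \<sigma> t n m =
     (SUP s\<in>{s \<in> sections d n - {0}. ord_sec d x \<sigma> t n s = m}.
        cmod (lead_sec d x \<sigma> t n s) / fs_sup_norm d n s)"

definition scaled_exponent :: "nat \<Rightarrow> (nat \<Rightarrow>\<^sub>0 nat) \<Rightarrow> nat \<Rightarrow> real" where
  "scaled_exponent n m = (\<lambda>j. real (lookup m j) / real n)"

text \<open>
  \<^term>\<open>Euclidean_space d\<close> is \<open>\<real>\<^sup>d\<close>, realised as the real sequences vanishing from index \<open>d\<close> on.
\<close>

definition okounkov_body ::
  "nat \<Rightarrow> (nat \<Rightarrow> complex) \<Rightarrow> mpol \<Rightarrow> (nat \<Rightarrow> (nat \<Rightarrow> complex) \<Rightarrow> complex) \<Rightarrow> (nat \<Rightarrow> real) set" where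
  "okounkov_body d x \<sigma> t =
     Euclidean_space d closure_of (\<Union>n\<in>{1..}. scaled_exponent n ` ord_set d x \<sigma> t n)"

definition chebyshev_limit ::
  "nat \<Rightarrow> (nat \<Rightarrow> complex) \<Rightarrow> mpol \<Rightarrow> (nat \<Rightarrow> (nat \<Rightarrow> complex) \<Rightarrow> complex) \<Rightarrow> (nat \<Rightarrow> real) \<Rightarrow>
    real \<Rightarrow> bool" where
  "chebyshev_limit d x \<sigma> t \<alpha> l \<longleftrightarrow>
     (\<forall>m. (\<forall>n\<ge>1. m n \<in> ord_set d x \<sigma> t n) \<longrightarrow>
          (\<lambda>n. scaled_exponent n (m n)) \<longlonglongrightarrow> \<alpha> \<longrightarrow>
          (\<lambda>n. 1 / real n * ln (lead_sup d x \<sigma> t n (m n))) \<longlonglongrightarrow> l)"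

text \<open>On the boundary of the Okounkov body the transform is defined by continuous extension.\<close>

definition chebyshev ::
  "nat \<Rightarrow> (nat \<Rightarrow> complex) \<Rightarrow> mpol \<Rightarrow> (nat \<Rightarrow> (nat \<Rightarrow> complex) \<Rightarrow> complex) \<Rightarrow> (nat \<Rightarrow> real) \<Rightarrow>
    real" where
  "chebyshev d x \<sigma> t \<alpha> =
     (let I = Euclidean_space d interior_of okounkov_body d x \<sigma> t;
          c = (\<lambda>\<beta>. THE l. chebyshev_limit d x \<sigma> t \<beta> l)
      in if \<alpha> \<in> I then c \<alpha> else Lim (at \<alpha> within I) c)"

text \<open>The hermitian inner product on linear forms for which the \<open>X\<^sub>i\<close> are orthonormal.\<close>

definition form_inner :: "nat \<Rightarrow> mpol \<Rightarrow> mpol \<Rightarrow> complex" where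
  "form_inner d p q =
     (\<Sum>i\<le>d. lookup p (Poly_Mapping.single i 1) * cnj (lookup q (Poly_Mapping.single i 1)))"

fun gram_schmidt :: "nat \<Rightarrow> (nat \<Rightarrow> mpol) \<Rightarrow> nat \<Rightarrow> mpol" where
  "gram_schmidt d Y j =
     (let w = Y j - (\<Sum>k<j. pscale (form_inner d (Y j) (gram_schmidt d Y k)) (gram_schmidt d Y k))
      in pscale (1 / csqrt (form_inner d w w)) w)"

declare gram_schmidt.simps [simp del]

definition entropy :: "nat \<Rightarrow> (nat \<Rightarrow> real) \<Rightarrow> real" where
  "entropy d \<beta> = (\<Sum>j\<le>d. \<beta> j * ln (1 / \<beta> j))"

end

theory Submission
  imports Defs
begin

text \<open>
  Let \<open>c j\<close> be the inner product of \<open>Y j\<close> with \<open>U j\<close>, so \<open>\<gamma> j = 1 / c j\<close>.  Two bases of monomials compete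
  in \<open>H\<^sup>0(\<O>(n))\<close>.  The monomials in \<open>Y\<close> know the local data: writing \<open>s = (\<Sum>m. a m Y\<^sup>m)\<close> over exponents
  \<open>m\<close> of total degree \<open>n\<close> and dividing by \<open>Y d ^ n\<close> gives the expansion of \<open>s\<close> in the local parameters, a
  finite one, in which \<open>a m\<close> belongs to the exponent formed by the first \<open>d\<close> entries of \<open>m\<close>.  So the order
  of \<open>s\<close> is given by the lexicographically least \<open>m\<close> with \<open>a m \<noteq> 0\<close> (\<open>ord_lead_lowest_term\<close>).  The monomials in \<open>U\<close>
  know the metric.

  The link is that Gram-Schmidt is triangular: \<open>Y j\<close> is \<open>c j\<close> times \<open>U j\<close> plus a combination of the \<open>U k\<close>
  with \<open>k < j\<close>, and these are the variables that count as larger in the lexicographic order, in which an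
  earlier index is more significant.  As lowest terms multiply, \<open>Y\<^sup>m\<close> is \<open>\<Prod>j. c j ^ m j\<close> times
  \<open>U\<^sup>m\<close> plus larger monomials.  So \<open>s = (\<Sum>m. b m U\<^sup>m)\<close> has the same order, and its leading coefficient
  for \<open>U\<close> is \<open>\<Prod>j. c j ^ m j\<close> times the one for \<open>Y\<close> (\<open>has_lowest_term_orthonormal_coeffs\<close>).

  Since \<open>U\<close> is orthonormal, the metric does not distinguish it from the coordinates.  Cauchy's
  estimate on the torus with radii \<open>sqrt (m j / n)\<close>, which lies in the unit sphere, bounds \<open>b m\<close> by
  the norm of \<open>s\<close> divided by \<open>V m = \<Prod>j. sqrt (m j / n) ^ m j\<close>; weighted AM-GM says that \<open>U\<^sup>m\<close> itself
  has norm at most \<open>V m\<close>.  So the supremum in question is attained by \<open>U\<^sup>m\<close> and is exactly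
  \<open>(\<Prod>j. \<gamma> j ^ m j) / V m\<close>, for every single \<open>n\<close> (\<open>lead_sup_eq\<close>).

  Its logarithm divided by \<open>n\<close> is the asserted formula evaluated at \<open>m / n\<close> (\<open>ln_lead_sup\<close>).  The formula
  is continuous on the whole simplex because \<open>b ln (1/b)\<close> tends to \<open>0\<close> with \<open>b\<close>; hence the limits exist
  at all its points, and the continuous extension to the boundary agrees with the formula.
\<close>

section \<open>Evaluation and substitution of polynomials\<close>

definition power_product :: "(nat \<Rightarrow> 'r::comm_ring_1) \<Rightarrow> (nat \<Rightarrow>\<^sub>0 nat) \<Rightarrow> 'r" where
  "power_product g m = (\<Prod>i\<in>keys m. g i ^ lookup m i)"

lemma power_product_superset:
  assumes "finite J" "keys m \<subseteq> J"
  shows "power_product g m = (\<Prod>i\<in>J. g i ^ lookup m i)"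
  unfolding power_product_def
  by (rule prod.mono_neutral_left) (use assms in \<open>auto simp: in_keys_iff\<close>)

lemma power_product_add: "power_product g (m + m') = power_product g m * power_product g m'"
proof -
  let ?J = "keys m \<union> keys m'"
  have "keys (m + m') \<subseteq> ?J"
    by (rule keys_add)
  then show ?thesis
    by (simp add: power_product_superset[of ?J] lookup_add power_add prod.distrib)
qed

lemma power_product_0 [simp]: "power_product g 0 = 1"
  by (simp add: power_product_def)

lemma power_product_single [simp]: "power_product g (Poly_Mapping.single i k) = g i ^ k"
  by (cases "k = 0") (simp_all add: power_product_def)

lemma sum_single_lookup: "(\<Sum>k\<in>keys p. Poly_Mapping.single k (lookup p k)) = p"
proof (rule poly_mapping_eqI)
  fix k
  have "(\<Sum>k'\<in>keys p. (lookup p k' when k' = k)) = (\<Sum>k'\<in>keys p \<inter> {k}. lookup p k)"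
    by (rule sum.mono_neutral_cong_right) auto
  also have "\<dots> = lookup p k"
    by (cases "k \<in> keys p") (auto simp: in_keys_iff)
  finally show "lookup (\<Sum>k\<in>keys p. Poly_Mapping.single k (lookup p k)) k = lookup p k"
    by (simp add: lookup_sum lookup_single)
qed

text \<open>
  Evaluation at complex numbers and substitution of polynomials are the same operation, for the two
  coefficient maps from \<open>\<complex>\<close> to \<open>\<complex>\<close> and to the polynomials; treating them together also
  makes their composition (\<open>ev_psubst\<close>) a single fact.
\<close>

locale scalar_hom =
  fixes \<phi> :: "complex \<Rightarrow> 'r::comm_ring_1"
  assumes hom_0: "\<phi> 0 = 0" and hom_1: "\<phi> 1 = 1"
    and hom_add: "\<phi> (a + b) = \<phi> a + \<phi> b" and hom_mult: "\<phi> (a * b) = \<phi> a * \<phi> b"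
begin

definition ev :: "(nat \<Rightarrow> 'r) \<Rightarrow> mpol \<Rightarrow> 'r" where
  "ev g p = (\<Sum>m\<in>keys p. \<phi> (lookup p m) * power_product g m)"

lemma ev_superset:
  assumes "finite A" "keys p \<subseteq> A"
  shows "ev g p = (\<Sum>m\<in>A. \<phi> (lookup p m) * power_product g m)"
  unfolding ev_def
  by (rule sum.mono_neutral_left) (use assms in \<open>auto simp: in_keys_iff hom_0\<close>)

lemma ev_0 [simp]: "ev g 0 = 0"
  by (simp add: ev_def)

lemma ev_single: "ev g (Poly_Mapping.single m c) = \<phi> c * power_product g m"
  by (simp add: ev_def hom_0)

lemma ev_1 [simp]: "ev g 1 = 1"
  using ev_single[of g 0 1] by (simp add: hom_1)

lemma ev_add: "ev g (p + q) = ev g p + ev g q"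
proof -
  let ?A = "keys p \<union> keys q"
  have "keys (p + q) \<subseteq> ?A"
    by (rule keys_add)
  then show ?thesis
    by (simp add: ev_superset[of ?A] lookup_add hom_add distrib_right sum.distrib)
qed

lemma ev_diff: "ev g (p - q) = ev g p - ev g q"
  using ev_add[of g "p - q" q] by (metis add_diff_cancel_right' diff_add_cancel)

lemma ev_sum: "ev g (\<Sum>i\<in>I. f i) = (\<Sum>i\<in>I. ev g (f i))"
  by (induction I rule: infinite_finite_induct) (simp_all add: ev_add)

lemma ev_mult: "ev g (p * q) = ev g p * ev g q"
proof -
  have "p * q = (\<Sum>m\<in>keys p. \<Sum>m'\<in>keys q.
      Poly_Mapping.single (m + m') (lookup p m * lookup q m'))"
    unfolding mult_single[symmetric] sum_product[symmetric] sum_single_lookup ..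
  then have "ev g (p * q) = (\<Sum>m\<in>keys p. \<Sum>m'\<in>keys q.
      (\<phi> (lookup p m) * power_product g m) * (\<phi> (lookup q m') * power_product g m'))"
    by (simp add: ev_sum ev_single hom_mult power_product_add ac_simps)
  then show ?thesis
    by (simp add: ev_def sum_product)
qed

lemma ev_power: "ev g (p ^ k) = ev g p ^ k"
  by (induction k) (simp_all add: ev_mult)

lemma ev_power_product: "ev g (power_product h m) = power_product (\<lambda>i. ev g (h i)) m"
  unfolding power_product_def
  by (induction rule: infinite_finite_induct) (simp_all add: ev_mult ev_power)

lemma ev_scalar: "ev g (Poly_Mapping.single 0 c * p) = \<phi> c * ev g p"
  by (simp add: ev_mult ev_single)

end

global_interpretation complex_eval: scalar_hom "\<lambda>c::complex. c"
  by unfold_locales simp_all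

global_interpretation mpol_subst: scalar_hom "Poly_Mapping.single 0 :: complex \<Rightarrow> mpol"
  defines psubst = mpol_subst.ev
  by unfold_locales (simp_all add: single_add mult_single)

lemma peval_eq_ev: "peval p y = complex_eval.ev y p"
  by (simp add: peval_def complex_eval.ev_def power_product_def)

lemma pscale_eq_mult: "pscale c p = Poly_Mapping.single 0 c * p"
  by (simp add: pscale_def mult_map_scale_conv_mult)

lemma (in scalar_hom) ev_psubst: "ev g (psubst h p) = ev (\<lambda>i. ev g (h i)) p"
  by (simp add: mpol_subst.ev_def ev_sum ev_scalar ev_power_product ev_def[of _ p])

lemmas peval_psubst = complex_eval.ev_psubst[folded peval_eq_ev]
lemmas psubst_psubst = mpol_subst.ev_psubst

definition var :: "nat \<Rightarrow> mpol" where
  "var i = Poly_Mapping.single (Poly_Mapping.single i 1) 1"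

lemma var_power: "var i ^ k = Poly_Mapping.single (Poly_Mapping.single i k) 1"
  by (induction k) (simp_all add: var_def mult_single flip: single_add)

lemma power_product_var: "power_product var m = Poly_Mapping.single m 1"
proof -
  have "(\<Prod>i\<in>A. var i ^ lookup m i)
      = Poly_Mapping.single (\<Sum>i\<in>A. Poly_Mapping.single i (lookup m i)) 1" if "finite A" for A
    using that by induction (simp_all add: var_power mult_single)
  then show ?thesis
    by (simp add: power_product_def sum_single_lookup)
qed

lemma psubst_var: "psubst var p = p"
  by (simp add: mpol_subst.ev_def power_product_var mult_single sum_single_lookup)

lemma peval_var [simp]: "peval (var i) y = y i"
  by (simp add: var_def peval_eq_ev complex_eval.ev_single)

lemma psubst_var_apply [simp]: "psubst g (var i) = g i"
  by (simp add: var_def mpol_subst.ev_single)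

section \<open>Homogeneous polynomials and linear forms\<close>

definition exponents :: "nat \<Rightarrow> nat \<Rightarrow> (nat \<Rightarrow>\<^sub>0 nat) set" where
  "exponents d n = {m. keys m \<subseteq> {..d} \<and> (\<Sum>i\<le>d. lookup m i) = n}"

lemma sections_eq: "sections d n = {p. keys p \<subseteq> exponents d n}"
proof -
  have "(\<Sum>i\<in>keys m. lookup m i) = (\<Sum>i\<le>d. lookup m i)" if "keys m \<subseteq> {..d}" for m :: "nat \<Rightarrow>\<^sub>0 nat"
    using that by (intro sum.mono_neutral_left) (auto simp: in_keys_iff)
  then show ?thesis
    unfolding sections_def exponents_def by auto
qed

lemma exponents_add:
  assumes "m \<in> exponents d a" "m' \<in> exponents d b"
  shows "m + m' \<in> exponents d (a + b)"
  using assms keys_add[of m m'] by (auto simp: exponents_def lookup_add sum.distrib)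

lemma single_in_exponents:
  assumes "i \<le> d"
  shows "Poly_Mapping.single i k \<in> exponents d k"
proof -
  have "(\<Sum>j\<le>d. lookup (Poly_Mapping.single i k) j) = (\<Sum>j\<in>{i}. k)"
    by (rule sum.mono_neutral_cong_right) (use assms in \<open>auto simp: lookup_single when_def\<close>)
  then show ?thesis
    using assms by (auto simp: exponents_def)
qed

lemma exponents_1: "exponents d 1 = (\<lambda>i. Poly_Mapping.single i 1) ` {..d}"
proof (intro equalityI subsetI)
  fix m assume "m \<in> exponents d 1"
  then have m: "keys m \<subseteq> {..d}" "(\<Sum>i\<le>d. lookup m i) = 1"
    by (auto simp: exponents_def)
  then obtain i where i: "i \<le> d" "lookup m i = 1" "\<And>j. j \<le> d \<Longrightarrow> j \<noteq> i \<Longrightarrow> lookup m j = 0"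
    using sum_eq_1_iff[of "{..d}" "lookup m"] by (metis atMost_iff finite_atMost)
  have "m = Poly_Mapping.single i 1"
  proof (rule poly_mapping_eqI)
    fix j show "lookup m j = lookup (Poly_Mapping.single i 1) j"
    proof (cases "j \<le> d")
      case True
      then show ?thesis
        using i by (cases "j = i") (simp_all add: lookup_single)
    next
      case False
      then have "lookup m j = 0"
        using m(1) by (metis atMost_iff in_keys_iff subsetD)
      then show ?thesis
        using i(1) False by (auto simp: lookup_single)
    qed
  qed
  with i show "m \<in> (\<lambda>i. Poly_Mapping.single i 1) ` {..d}"
    by auto
next
  fix m assume "m \<in> (\<lambda>i. Poly_Mapping.single i (1::nat)) ` {..d}"
  then show "m \<in> exponents d 1"
    by (metis atMost_iff imageE single_in_exponents)
qed

lemma sections_0 [simp]: "0 \<in> sections d n"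
  by (simp add: sections_eq)

lemma sections_single: "m \<in> exponents d n \<Longrightarrow> Poly_Mapping.single m c \<in> sections d n"
  by (simp add: sections_eq)

lemma var_in_sections: "i \<le> d \<Longrightarrow> var i \<in> sections d 1"
  unfolding var_def by (intro sections_single single_in_exponents)

lemma sections_add: "p \<in> sections d n \<Longrightarrow> q \<in> sections d n \<Longrightarrow> p + q \<in> sections d n"
  using keys_add[of p q] unfolding sections_eq by blast

lemma sections_sum: "(\<And>i. i \<in> I \<Longrightarrow> f i \<in> sections d n) \<Longrightarrow> (\<Sum>i\<in>I. f i) \<in> sections d n"
  by (induction I rule: infinite_finite_induct) (simp_all add: sections_add)

lemma sections_mult:
  assumes "p \<in> sections d a" "q \<in> sections d b"
  shows "p * q \<in> sections d (a + b)"
proof -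
  have "{k + l |k l. k \<in> keys p \<and> l \<in> keys q} \<subseteq> exponents d (a + b)"
    using assms exponents_add unfolding sections_eq by blast
  with keys_mult[of p q] show ?thesis
    by (simp add: sections_eq)
qed

lemma scalar_in_sections: "Poly_Mapping.single 0 c \<in> sections d 0"
  using sections_single[of 0 d 0 c] by (simp add: exponents_def)

lemma sections_pscale: "p \<in> sections d n \<Longrightarrow> pscale c p \<in> sections d n"
  using sections_mult[OF scalar_in_sections, of p d n c] by (simp add: pscale_eq_mult)

lemma sections_diff:
  assumes "p \<in> sections d n" "q \<in> sections d n"
  shows "p - q \<in> sections d n"
proof -
  have "p - q = p + pscale (-1) q"
    by (rule poly_mapping_eqI) (simp add: lookup_pscale lookup_add lookup_minus)
  then show ?thesis
    using sections_add[OF assms(1) sections_pscale[OF assms(2), of "-1"]] by simp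
qed

lemma sections_power: "p \<in> sections d 1 \<Longrightarrow> p ^ k \<in> sections d k"
proof (induction k)
  case 0
  then show ?case using scalar_in_sections[of 1 d] by simp
next
  case (Suc k)
  then show ?case using sections_mult[of p d 1 "p ^ k" k] by simp
qed

lemma power_product_in_sections:
  assumes "\<And>i. i \<le> d \<Longrightarrow> q i \<in> sections d 1" "m \<in> exponents d n"
  shows "power_product q m \<in> sections d n"
proof -
  have "(\<Prod>i\<in>A. q i ^ lookup m i) \<in> sections d (\<Sum>i\<in>A. lookup m i)" if "A \<subseteq> {..d}" for A
    using finite_subset[OF that finite_atMost] that
  proof (induction A rule: finite_induct)
    case empty
    then show ?case using scalar_in_sections[of 1 d] by simp
  next
    case (insert i A)
    then show ?case using assms(1) by (simp add: sections_mult sections_power)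
  qed
  from this[of "{..d}"] show ?thesis
    using assms(2) by (simp add: exponents_def power_product_superset[of "{..d}"])
qed

lemma psubst_in_sections:
  assumes "\<And>i. i \<le> d \<Longrightarrow> q i \<in> sections d 1" "p \<in> sections d n"
  shows "psubst q p \<in> sections d n"
  unfolding mpol_subst.ev_def pscale_eq_mult[symmetric]
proof (intro sections_sum sections_pscale power_product_in_sections)
  fix m assume "m \<in> keys p"
  then show "m \<in> exponents d n"
    using assms(2) by (auto simp: sections_eq)
qed (use assms(1) in blast)

lemma (in scalar_hom) ev_cong:
  assumes "p \<in> sections d n" "\<And>i. i \<le> d \<Longrightarrow> g i = h i"
  shows "ev g p = ev h p"
  unfolding ev_def power_product_def
proof (intro sum.cong prod.cong refl arg_cong2[where f = "(*)"] arg_cong2[where f = "(^)"])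
  fix m i assume "m \<in> keys p" "i \<in> keys m"
  then have "i \<le> d"
    using assms(1) unfolding sections_eq exponents_def by blast
  then show "g i = h i"
    by (rule assms(2))
qed

lemmas peval_cong = complex_eval.ev_cong[folded peval_eq_ev]

abbreviation form_coeff :: "mpol \<Rightarrow> nat \<Rightarrow> complex" where
  "form_coeff p i \<equiv> lookup p (Poly_Mapping.single i 1)"

lemma inj_single_1: "inj (\<lambda>i::nat. Poly_Mapping.single i (1::nat))"
proof (rule injI)
  fix i j :: nat
  assume "Poly_Mapping.single i (1::nat) = Poly_Mapping.single j 1"
  then have "keys (Poly_Mapping.single i (1::nat)) = keys (Poly_Mapping.single j (1::nat))"
    by simp
  then show "i = j"
    by simp
qed

lemma (in scalar_hom) ev_form:
  assumes "p \<in> sections d 1"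
  shows "ev g p = (\<Sum>i\<le>d. \<phi> (form_coeff p i) * g i)"
proof -
  have "keys p \<subseteq> (\<lambda>i. Poly_Mapping.single i 1) ` {..d}"
    using assms unfolding sections_eq exponents_1 by blast
  then have "ev g p = (\<Sum>m\<in>(\<lambda>i. Poly_Mapping.single i 1) ` {..d}. \<phi> (lookup p m) * power_product g m)"
    by (intro ev_superset) auto
  also have "\<dots> = (\<Sum>i\<le>d. \<phi> (form_coeff p i) * g i)"
    by (subst sum.reindex) (use inj_on_subset[OF inj_single_1] in auto)
  finally show ?thesis .
qed

lemmas peval_form = complex_eval.ev_form[folded peval_eq_ev]
lemmas psubst_form = mpol_subst.ev_form[folded pscale_eq_mult]

section \<open>Lowest terms\<close>

text \<open>
  The value \<open>c = 0\<close> is admitted, so that the notion is preserved under products over any coefficient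
  ring.
\<close>

definition has_lowest_term ::
  "('k::linorder \<Rightarrow>\<^sub>0 'r::zero) \<Rightarrow> 'k \<Rightarrow> 'r \<Rightarrow> bool" where
  "has_lowest_term p m c \<longleftrightarrow> lookup p m = c \<and> (\<forall>m'<m. lookup p m' = 0)"

lemma less_iff_lex:
  fixes m m' :: "nat \<Rightarrow>\<^sub>0 nat"
  shows "m < m' \<longleftrightarrow> (\<exists>k. lookup m k < lookup m' k \<and> (\<forall>k'<k. lookup m k' = lookup m' k'))"
  by (simp add: less_poly_mapping.rep_eq less_fun_def)

lemma has_lowest_term_iff_single_add:
  fixes p :: "'k::linorder \<Rightarrow>\<^sub>0 'r::comm_ring_1"
  shows "has_lowest_term p m c \<longleftrightarrow> (\<exists>r. keys r \<subseteq> {m<..} \<and> p = Poly_Mapping.single m c + r)"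
proof
  assume p: "has_lowest_term p m c"
  have "keys (p - Poly_Mapping.single m c) \<subseteq> {m<..}"
  proof
    fix k assume k: "k \<in> keys (p - Poly_Mapping.single m c)"
    show "k \<in> {m<..}"
      using p k by (cases k m rule: linorder_cases)
        (auto simp: has_lowest_term_def in_keys_iff lookup_minus lookup_single_not_eq)
  qed
  then show "\<exists>r. keys r \<subseteq> {m<..} \<and> p = Poly_Mapping.single m c + r"
    by (intro exI[of _ "p - Poly_Mapping.single m c"]) simp
next
  assume "\<exists>r. keys r \<subseteq> {m<..} \<and> p = Poly_Mapping.single m c + r"
  then obtain r where r: "keys r \<subseteq> {m<..}" "p = Poly_Mapping.single m c + r"
    by blast
  then have "lookup r m' = 0" if "m' \<le> m" for m'
    using that by (metis greaterThan_iff in_keys_iff in_mono leD)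
  then show "has_lowest_term p m c"
    using r(2) by (auto simp: has_lowest_term_def lookup_add lookup_single when_def)
qed

text \<open>
  A sum of two exponents, one at least \<open>m\<close> and the other at least \<open>m'\<close>, equals \<open>m + m'\<close> only if both
  are equal, because addition is strictly monotone.
\<close>

lemma has_lowest_term_mult:
  fixes p q :: "'k::{ordered_cancel_comm_monoid_add, linorder} \<Rightarrow>\<^sub>0 'r::comm_ring_1"
  assumes "has_lowest_term p m c" "has_lowest_term q m' c'"
  shows "has_lowest_term (p * q) (m + m') (c * c')"
proof -
  obtain r r' where r: "keys r \<subseteq> {m<..}" "p = Poly_Mapping.single m c + r"
    and r': "keys r' \<subseteq> {m'<..}" "q = Poly_Mapping.single m' c' + r'"
    using assms by (auto simp: has_lowest_term_iff_single_add)
  let ?R = "Poly_Mapping.single m c * r' + r * Poly_Mapping.single m' c' + r * r'"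
  have eq: "p * q = Poly_Mapping.single (m + m') (c * c') + ?R"
    by (simp add: r(2) r'(2) algebra_simps mult_single)
  have "keys (Poly_Mapping.single m c * r') \<subseteq> {m + m'<..}"
    by (rule subset_trans[OF keys_mult]) (use r'(1) in \<open>auto intro: add_strict_left_mono split: if_splits\<close>)
  moreover have "keys (r * Poly_Mapping.single m' c') \<subseteq> {m + m'<..}"
    by (rule subset_trans[OF keys_mult]) (use r(1) in \<open>auto intro: add_strict_right_mono split: if_splits\<close>)
  moreover have "keys (r * r') \<subseteq> {m + m'<..}"
    by (rule subset_trans[OF keys_mult]) (use r(1) r'(1) in \<open>auto intro: add_strict_mono\<close>)
  ultimately have "keys ?R \<subseteq> {m + m'<..}"
    using keys_add by (meson Un_least subset_trans)
  with eq show ?thesis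
    unfolding has_lowest_term_iff_single_add by blast
qed

lemma has_lowest_term_1: "has_lowest_term (1::mpol) 0 1"
  unfolding has_lowest_term_iff_single_add by (intro exI[of _ 0]) simp

lemma has_lowest_term_power_product:
  fixes q :: "nat \<Rightarrow> mpol"
  assumes "\<And>i. i \<in> keys m \<Longrightarrow> has_lowest_term (q i) (Poly_Mapping.single i 1) (c i)"
  shows "has_lowest_term (power_product q m) m (power_product c m)"
proof -
  have pow: "has_lowest_term (q i ^ k) (Poly_Mapping.single i k) (c i ^ k)" if "i \<in> keys m" for i k
  proof (induction k)
    case 0
    then show ?case using has_lowest_term_1 by simp
  next
    case (Suc k)
    then show ?case
      using has_lowest_term_mult[OF assms[OF that] Suc] by (simp flip: single_add)
  qed
  have "has_lowest_term (\<Prod>i\<in>A. q i ^ lookup m i)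
      (\<Sum>i\<in>A. Poly_Mapping.single i (lookup m i)) (\<Prod>i\<in>A. c i ^ lookup m i)"
    if "A \<subseteq> keys m" for A
    using finite_subset[OF that finite_keys] that
  proof (induction A rule: finite_induct)
    case empty
    show ?case using has_lowest_term_1 by simp
  next
    case (insert i A)
    then show ?case using has_lowest_term_mult[OF pow] by simp
  qed
  then show ?thesis
    unfolding power_product_def using sum_single_lookup[of m] by fastforce
qed

text \<open>
  A triangular substitution preserves the lowest exponent: a monomial \<open>k\<close> of \<open>a\<close> becomes a
  polynomial that starts at \<open>k\<close>, so nothing but the lowest monomial of \<open>a\<close> contributes at or below \<open>m\<close>.
\<close>

lemma has_lowest_term_psubst:
  assumes q: "\<And>j. j \<le> d \<Longrightarrow> has_lowest_term (q j) (Poly_Mapping.single j 1) (c j)"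
    and a: "a \<in> sections d n" "has_lowest_term a m \<kappa>"
  shows "has_lowest_term (psubst q a) m (\<kappa> * power_product c m)"
proof -
  have low: "has_lowest_term (power_product q k) k (power_product c k)" if "k \<in> keys a" for k
    using that a(1) by (intro has_lowest_term_power_product q) (auto simp: sections_eq exponents_def)
  have ge: "m \<le> k" if "k \<in> keys a" for k
    using a(2) that by (auto simp: has_lowest_term_def in_keys_iff not_le[symmetric])
  have lk: "lookup (psubst q a) k' = (\<Sum>k\<in>keys a. lookup a k * lookup (power_product q k) k')" for k'
    by (simp add: mpol_subst.ev_def lookup_sum lookup_pscale flip: pscale_eq_mult)
  have "lookup (psubst q a) m = (\<Sum>k\<in>keys a \<inter> {m}. \<kappa> * power_product c m)"
    unfolding lk
    by (rule sum.mono_neutral_cong_right)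
       (use low ge a(2) in \<open>auto simp: has_lowest_term_def order.strict_iff_order\<close>)
  moreover have "lookup (psubst q a) k' = 0" if "k' < m" for k'
    unfolding lk by (rule sum.neutral) (use low ge that in \<open>force simp: has_lowest_term_def\<close>)
  ultimately show ?thesis
    using a(2) by (cases "m \<in> keys a") (auto simp: has_lowest_term_def in_keys_iff)
qed

lemma ex_lowest_term:
  fixes p :: "'k::linorder \<Rightarrow>\<^sub>0 'r::zero"
  assumes "p \<noteq> 0"
  obtains m where "m \<in> keys p" "has_lowest_term p m (lookup p m)"
proof
  have ne: "keys p \<noteq> {}"
    using assms by (metis empty_iff in_keys_iff lookup_zero poly_mapping_eqI)
  then show "Min (keys p) \<in> keys p"
    by simp
  show "has_lowest_term p (Min (keys p)) (lookup p (Min (keys p)))"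
    unfolding has_lowest_term_def by (meson Min_le finite_keys in_keys_iff leD)
qed

section \<open>Cauchy's estimate by averaging over roots of unity\<close>

definition unity_root :: "nat \<Rightarrow> nat \<Rightarrow> complex" where
  "unity_root N j = exp (2 * of_real pi * \<i> * of_nat j / of_nat N)"

lemma norm_unity_root [simp]: "cmod (unity_root N j) = 1"
  by (simp add: unity_root_def norm_exp_eq_Re)

lemma unity_root_neq_0 [simp]: "unity_root N j \<noteq> 0"
  by (simp add: unity_root_def)

lemma unity_root_power_swap: "unity_root N j ^ k = unity_root N k ^ j"
  by (simp add: unity_root_def exp_of_nat_mult[symmetric] ac_simps)

lemma unity_root_eq_iff: "N > 0 \<Longrightarrow> unity_root N j = unity_root N k \<longleftrightarrow> j mod N = k mod N"
  unfolding unity_root_def by (rule complex_root_unity_eq) simp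

lemma unity_root_self: "N > 0 \<Longrightarrow> unity_root N N = 1"
  using unity_root_eq_iff[of N N 0] by (simp add: unity_root_def)

lemma sum_unity_root:
  assumes "N > 0"
  shows "(\<Sum>k<N. unity_root N k ^ a / unity_root N k ^ b)
    = (if a mod N = b mod N then of_nat N else 0)"
proof -
  define \<zeta> where "\<zeta> = unity_root N a / unity_root N b"
  have "(\<Sum>k<N. unity_root N k ^ a / unity_root N k ^ b) = (\<Sum>k<N. \<zeta> ^ k)"
    by (simp add: \<zeta>_def power_divide unity_root_power_swap[of N _ a] unity_root_power_swap[of N _ b])
  moreover have "\<zeta> ^ N = 1"
    using assms by (simp add: \<zeta>_def power_divide unity_root_power_swap[of N _ N] unity_root_self)
  moreover have "\<zeta> = 1 \<longleftrightarrow> a mod N = b mod N"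
    using assms by (simp add: \<zeta>_def unity_root_eq_iff)
  ultimately show ?thesis
    by (cases "\<zeta> = 1") (simp_all add: sum_gp_strict)
qed

text \<open>
  The sum over the finite torus factors into one geometric sum for each coordinate.
\<close>

lemma torus_orthogonality:
  assumes "finite J" "N > 0"
  shows "(\<Sum>k\<in>J \<rightarrow>\<^sub>E {..<N}. \<Prod>j\<in>J. unity_root N (k j) ^ a j / unity_root N (k j) ^ b j)
    = (if \<forall>j\<in>J. a j mod N = b j mod N then of_nat (N ^ card J) else 0)"
proof -
  have "(\<Sum>k\<in>J \<rightarrow>\<^sub>E {..<N}. \<Prod>j\<in>J. unity_root N (k j) ^ a j / unity_root N (k j) ^ b j)
    = (\<Prod>j\<in>J. if a j mod N = b j mod N then of_nat N else 0)"
    using assms by (subst prod_sum_PiE[symmetric]) (simp_all add: sum_unity_root)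
  also have "\<dots> = (if \<forall>j\<in>J. a j mod N = b j mod N then of_nat (N ^ card J) else 0)"
    using assms(1) by (auto simp: prod_zero_iff)
  finally show ?thesis .
qed

lemma has_sum_sum_family:
  fixes f :: "'k \<Rightarrow> 'i \<Rightarrow> complex"
  assumes "finite K" "\<And>k. k \<in> K \<Longrightarrow> (f k has_sum s k) A"
  shows "((\<lambda>i. \<Sum>k\<in>K. f k i) has_sum (\<Sum>k\<in>K. s k)) A"
  using assms by (induction K rule: finite_induct) (auto intro!: has_sum_add)

text \<open>
  The classical proof integrates over the torus.  Averaging over the \<open>N\<close>-th roots of unity
  instead isolates the coefficients with exponents congruent to \<open>m\<close> modulo \<open>N\<close>; for large \<open>N\<close>, all of
  these except \<open>m\<close> itself lie in the tail of an absolutely convergent series.  With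
  \<open>B = 0\<close> and positive radii the estimate is the identity theorem for power series.
\<close>

lemma cauchy_estimate:
  fixes c :: "(nat \<Rightarrow>\<^sub>0 nat) \<Rightarrow> complex" and r :: "nat \<Rightarrow> real"
  assumes J: "finite J" and r: "\<And>j. j \<in> J \<Longrightarrow> r j \<ge> 0"
    and series: "\<And>z. (\<And>j. j \<in> J \<Longrightarrow> cmod (z j) = r j) \<Longrightarrow>
      ((\<lambda>k. c k * (\<Prod>j\<in>J. z j ^ lookup k j)) has_sum f z) {k. keys k \<subseteq> J}"
    and bound: "\<And>z. (\<And>j. j \<in> J \<Longrightarrow> cmod (z j) = r j) \<Longrightarrow> cmod (f z) \<le> B"
    and m: "keys m \<subseteq> J"
  shows "cmod (c m) * (\<Prod>j\<in>J. r j ^ lookup m j) \<le> B"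
proof (rule field_le_epsilon)
  fix \<delta> :: real assume "\<delta> > 0"
  define A where "A = {k :: nat \<Rightarrow>\<^sub>0 nat. keys k \<subseteq> J}"
  define g where "g k = c k * (\<Prod>j\<in>J. of_real (r j) ^ lookup k j)" for k
  have "(g has_sum f (\<lambda>j. of_real (r j))) A"
    unfolding g_def A_def using r by (intro series) auto
  then have abs: "(\<lambda>k. norm (g k)) summable_on A"
    by (simp add: summable_on_iff_abs_summable_on_complex[symmetric] has_sum_imp_summable)
  obtain F where F: "finite F" "F \<subseteq> A"
    "dist (\<Sum>k\<in>F. norm (g k)) (\<Sum>\<^sub>\<infinity>k\<in>A. norm (g k)) \<le> \<delta>"
    using infsum_finite_approximation[OF abs \<open>\<delta> > 0\<close>] by blast
  define G where "G = insert m F"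
  have G: "finite G" "G \<subseteq> A" "m \<in> G"
    using F m by (auto simp: G_def A_def)
  have tail: "((\<lambda>k. norm (g k)) has_sum ((\<Sum>\<^sub>\<infinity>k\<in>A. norm (g k)) - (\<Sum>k\<in>G. norm (g k)))) (A - G)"
    by (rule has_sum_Diff) (use abs G in auto)
  have "(\<Sum>k\<in>F. norm (g k)) \<le> (\<Sum>k\<in>G. norm (g k))"
    using G by (intro sum_mono2) (auto simp: G_def)
  then have tail_le: "(\<Sum>\<^sub>\<infinity>k\<in>A. norm (g k)) - (\<Sum>k\<in>G. norm (g k)) \<le> \<delta>"
    using F(3) by (simp add: dist_real_def)
  \<comment> \<open>This \<open>N\<close> exceeds all entries of exponents in \<open>G\<close>, so congruent exponents in \<open>G\<close> are equal.\<close>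
  define N where "N = Suc (\<Sum>k\<in>G. \<Sum>j\<in>J. lookup k j)"
  have N_pos: "N > 0"
    by (simp add: N_def)
  have less_N: "lookup k j < N" if "k \<in> G" "j \<in> J" for k j
  proof -
    have "lookup k j \<le> (\<Sum>j\<in>J. lookup k j)"
      using that J by (intro member_le_sum) auto
    also have "\<dots> \<le> (\<Sum>k\<in>G. \<Sum>j\<in>J. lookup k j)"
      using that G by (intro member_le_sum) auto
    finally show ?thesis
      by (simp add: N_def)
  qed
  define congruent where "congruent k \<longleftrightarrow> (\<forall>j\<in>J. lookup k j mod N = lookup m j mod N)" for k
  have congruent_G: "k = m" if "k \<in> G" "congruent k" for k
  proof (rule poly_mapping_eqI)
    fix j show "lookup k j = lookup m j"
    proof (cases "j \<in> J")
      case True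
      then show ?thesis
        using that less_N[of k j] less_N[of m j] G(3) by (metis congruent_def mod_less)
    next
      case False
      then show ?thesis
        using that(1) m G(2) unfolding A_def by (metis in_keys_iff in_mono mem_Collect_eq)
    qed
  qed
  define K where "K = J \<rightarrow>\<^sub>E {..<N}"
  \<comment> \<open>\<open>S\<close> is the average of \<open>f (z k) / w k\<close> over the torus points \<open>z k\<close>; as \<open>w k\<close> has modulus \<open>1\<close>,
    \<open>S\<close> is bounded by \<open>B\<close>, and it is the sum of the terms congruent to \<open>m\<close>.\<close>
  define z where "z k j = of_real (r j) * unity_root N (k j)" for k :: "nat \<Rightarrow> nat" and j
  define w where "w k = (\<Prod>j\<in>J. unity_root N (k j) ^ lookup m j)" for k :: "nat \<Rightarrow> nat"
  define S where "S = (\<Sum>k\<in>K. f (z k) / w k) / of_nat (N ^ card J)"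
  have K: "finite K" "card K = N ^ card J"
    using J by (auto simp: K_def finite_PiE card_PiE)
  have norm_z: "cmod (z k j) = r j" if "j \<in> J" for k j
    using r[OF that] by (simp add: z_def norm_mult)
  have norm_w: "cmod (w k) = 1" for k
    by (simp add: w_def prod_norm[symmetric] norm_power)
  have "((\<lambda>i. \<Sum>k\<in>K. c i * (\<Prod>j\<in>J. z k j ^ lookup i j) / w k) has_sum
      (\<Sum>k\<in>K. f (z k) / w k)) A"
    unfolding A_def using norm_z K(1)
    by (intro has_sum_sum_family has_sum_divide_const series) auto
  moreover have "(\<Sum>k\<in>K. c i * (\<Prod>j\<in>J. z k j ^ lookup i j) / w k)
      = (if congruent i then g i * of_nat (N ^ card J) else 0)" for i
  proof -
    have "c i * (\<Prod>j\<in>J. z k j ^ lookup i j) / w k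
        = g i * (\<Prod>j\<in>J. unity_root N (k j) ^ lookup i j / unity_root N (k j) ^ lookup m j)" for k
      by (simp add: g_def z_def w_def power_mult_distrib prod.distrib prod_dividef)
    then show ?thesis
      using torus_orthogonality[OF J, of N "lookup i" "lookup m"]
      by (simp add: sum_distrib_left[symmetric] K_def congruent_def N_def)
  qed
  ultimately have "((\<lambda>i. if congruent i then g i * of_nat (N ^ card J) else 0) has_sum
      (\<Sum>k\<in>K. f (z k) / w k)) A"
    by simp
  then have "((\<lambda>i. (if congruent i then g i * of_nat (N ^ card J) else 0) / of_nat (N ^ card J))
      has_sum S) A"
    unfolding S_def by (rule has_sum_divide_const)
  moreover have "(if congruent i then g i * of_nat (N ^ card J) else 0) / of_nat (N ^ card J)
      = (if congruent i then g i else 0)" for i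
    using N_pos by simp
  ultimately have "((\<lambda>i. if congruent i then g i else 0) has_sum S) A"
    by simp
  then have "((\<lambda>i. if congruent i then g i else 0) has_sum (S - (\<Sum>i\<in>G. if congruent i then g i else 0))) (A - G)"
    by (rule has_sum_Diff[OF _ has_sum_finite[OF G(1)] G(2)])
  moreover have "(\<Sum>i\<in>G. if congruent i then g i else 0) = (\<Sum>i\<in>{m}. g i)"
  proof (rule sum.mono_neutral_cong_right)
    show "\<forall>i\<in>G - {m}. (if congruent i then g i else 0) = 0"
      using congruent_G by auto
  qed (use G in \<open>auto simp: congruent_def\<close>)
  ultimately have "((\<lambda>i. if congruent i then g i else 0) has_sum (S - g m)) (A - G)"
    by simp
  then have "norm (S - g m) \<le> (\<Sum>\<^sub>\<infinity>k\<in>A. norm (g k)) - (\<Sum>k\<in>G. norm (g k))"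
    by (rule norm_infsum_le) (use tail in auto)
  moreover have "norm S \<le> B"
  proof -
    have "norm (\<Sum>k\<in>K. f (z k) / w k) \<le> (\<Sum>k\<in>K. B)"
      using bound[OF norm_z] by (intro sum_norm_le) (simp add: norm_divide norm_w)
    then show ?thesis
      using K(2) N_pos by (simp add: S_def norm_divide norm_power divide_le_eq mult.commute)
  qed
  moreover have "norm (g m) \<le> norm S + norm (S - g m)"
    by (metis norm_minus_commute norm_triangle_sub)
  moreover have "norm (g m) = cmod (c m) * (\<Prod>j\<in>J. r j ^ lookup m j)"
    using r by (simp add: g_def norm_mult prod_norm[symmetric] norm_power)
  ultimately show "cmod (c m) * (\<Prod>j\<in>J. r j ^ lookup m j) \<le> B + \<delta>"
    using tail_le by linarith
qed

lemma peval_has_sum: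
  assumes "finite J" "\<And>m. m \<in> keys p \<Longrightarrow> keys m \<subseteq> J"
  shows "((\<lambda>m. lookup p m * (\<Prod>j\<in>J. z j ^ lookup m j)) has_sum peval p z) {m. keys m \<subseteq> J}"
proof (rule has_sum_finite_neutralI[of "keys p"])
  show "peval p z = (\<Sum>m\<in>keys p. lookup p m * (\<Prod>j\<in>J. z j ^ lookup m j))"
    unfolding peval_eq_ev complex_eval.ev_def
    by (intro sum.cong refl) (use assms in \<open>simp add: power_product_superset[of J]\<close>)
qed (use assms in \<open>auto simp: in_keys_iff\<close>)

lemma polynomial_cauchy_estimate:
  assumes p: "p \<in> sections d n" and "\<And>j. j \<le> d \<Longrightarrow> r j \<ge> 0"
    and "\<And>z. (\<And>j. j \<le> d \<Longrightarrow> cmod (z j) = r j) \<Longrightarrow> cmod (peval p z) \<le> B"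
    and "m \<in> exponents d n"
  shows "cmod (lookup p m) * (\<Prod>j\<le>d. r j ^ lookup m j) \<le> B"
  by (rule cauchy_estimate[where f = "peval p"])
     (use assms in \<open>auto intro!: peval_has_sum simp: sections_eq exponents_def\<close>)

lemma section_eq_0_if_peval_eq_0:
  assumes "p \<in> sections d n" "\<And>z. peval p z = 0"
  shows "p = 0"
proof (rule poly_mapping_eqI)
  fix m
  show "lookup p m = lookup 0 m"
  proof (cases "m \<in> exponents d n")
    case True
    then have "cmod (lookup p m) * (\<Prod>j\<le>d. 1 ^ lookup m j) \<le> 0"
      using assms by (intro polynomial_cauchy_estimate[of _ d n]) auto
    then show ?thesis by simp
  next
    case False
    then show ?thesis using assms(1) by (auto simp: sections_eq in_keys_iff)
  qed
qed

section \<open>Expansions in local parameters\<close>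

text \<open>
  Two expansions differ by a power series that vanishes wherever the parameters take their values near
  \<open>x\<close>.  The condition \<open>onto\<close> is what makes these values fill whole tori, so that the identity theorem
  applies.
\<close>

lemma expansion_unique:
  assumes onto: "\<And>P. eventually P (nhds x) \<Longrightarrow>
      \<exists>\<epsilon>>0. \<forall>z. (\<forall>j<d. cmod (z j) = \<epsilon>) \<longrightarrow> (\<exists>y. P y \<and> (\<forall>j<d. t j y = z j))"
    and a: "is_expansion d x \<sigma> t n s a" and b: "is_expansion d x \<sigma> t n s b"
  shows "a = b"
proof
  fix m
  define P where "P y \<longleftrightarrow> ((\<lambda>m. (a m - b m) * (\<Prod>j<d. t j y ^ lookup m j)) has_sum 0)
      {m. keys m \<subseteq> {..<d}}" for y
  have "eventually P (nhds x)"
    using a[unfolded is_expansion_def, THEN conjunct2] b[unfolded is_expansion_def, THEN conjunct2]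
    unfolding P_def
  proof eventually_elim
    case (elim y)
    from has_sum_add[OF elim(1) has_sum_uminusI[OF elim(2)]] show ?case
      by (simp add: algebra_simps)
  qed
  then obtain \<epsilon> where \<epsilon>: "\<epsilon> > 0"
    "\<And>z. (\<forall>j<d. cmod (z j) = \<epsilon>) \<Longrightarrow> \<exists>y. P y \<and> (\<forall>j<d. t j y = z j)"
    using onto by blast
  show "a m = b m"
  proof (cases "keys m \<subseteq> {..<d}")
    case True
    have "cmod (a m - b m) * (\<Prod>j<d. \<epsilon> ^ lookup m j) \<le> 0"
    proof (rule cauchy_estimate[where f = "\<lambda>_. 0"])
      fix z :: "nat \<Rightarrow> complex" assume "\<And>j. j \<in> {..<d} \<Longrightarrow> cmod (z j) = \<epsilon>"
      then obtain y where "P y" "\<forall>j<d. t j y = z j"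
        using \<epsilon>(2)[of z] by auto
      then show "((\<lambda>k. (a k - b k) * (\<Prod>j<d. z j ^ lookup k j)) has_sum 0) {k. keys k \<subseteq> {..<d}}"
        by (simp add: P_def)
    qed (use \<epsilon>(1) True in auto)
    moreover have "(\<Prod>j<d. \<epsilon> ^ lookup m j) > 0"
      using \<epsilon>(1) by (intro prod_pos) auto
    ultimately show ?thesis
      by (simp add: mult_le_0_iff)
  next
    case False
    then show ?thesis using a b by (simp add: is_expansion_def)
  qed
qed

lemma tendsto_peval:
  assumes "\<And>i. (\<lambda>n. y n i) \<longlonglongrightarrow> l i"
  shows "(\<lambda>n. peval p (y n)) \<longlonglongrightarrow> peval p l"
  unfolding peval_def by (intro tendsto_intros assms)

lemma continuous_peval: "continuous_on UNIV (peval p)"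
proof -
  have "continuous_on UNIV (\<lambda>y. peval p y)"
    unfolding peval_def by (intro continuous_intros continuous_on_product_coordinates)
  then show ?thesis by simp
qed

lemma tendsto_fun_iff:
  fixes f :: "'a \<Rightarrow> 'b \<Rightarrow> 'c::topological_space"
  shows "(f \<longlongrightarrow> l) F \<longleftrightarrow> (\<forall>i. ((\<lambda>a. f a i) \<longlongrightarrow> l i) F)"
  using limitin_componentwise[of "\<lambda>_. euclidean :: 'c topology" UNIV f l F]
  by (simp add: euclidean_product_topology)

definition parameter_exponents :: "nat \<Rightarrow> nat \<Rightarrow> (nat \<Rightarrow>\<^sub>0 nat) set" where
  "parameter_exponents d n = {\<mu>. keys \<mu> \<subseteq> {..<d} \<and> (\<Sum>j<d. lookup \<mu> j) \<le> n}"

text \<open>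
  Multiplication by \<open>Y d ^ n\<close> turns the exponent \<open>\<mu>\<close> of a monomial in the local parameters into the exponent
  \<open>homogenize d n \<mu>\<close> of a monomial in \<open>Y\<close>.  For total degree above \<open>n\<close> the subtraction truncates and
  the result is not in \<open>exponents d n\<close>, where sections have their support; so the coefficient read
  off there is \<open>0\<close>, as it should be.
\<close>

definition homogenize :: "nat \<Rightarrow> nat \<Rightarrow> (nat \<Rightarrow>\<^sub>0 nat) \<Rightarrow> (nat \<Rightarrow>\<^sub>0 nat)" where
  "homogenize d n \<mu> = \<mu> + Poly_Mapping.single d (n - (\<Sum>j<d. lookup \<mu> j))"

lemma lookup_homogenize_less [simp]: "j < d \<Longrightarrow> lookup (homogenize d n \<mu>) j = lookup \<mu> j"
  by (simp add: homogenize_def lookup_add lookup_single)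

lemma lookup_homogenize_last:
  "keys \<mu> \<subseteq> {..<d} \<Longrightarrow> lookup (homogenize d n \<mu>) d = n - (\<Sum>j<d. lookup \<mu> j)"
  by (auto simp: homogenize_def lookup_add in_keys_iff)

lemma keys_homogenize: "keys \<mu> \<subseteq> {..<d} \<Longrightarrow> keys (homogenize d n \<mu>) \<subseteq> {..d}"
  using keys_add[of \<mu> "Poly_Mapping.single d (n - (\<Sum>j<d. lookup \<mu> j))"]
  by (fastforce simp: homogenize_def split: if_splits)

lemma sum_homogenize:
  assumes "keys \<mu> \<subseteq> {..<d}"
  shows "(\<Sum>j\<le>d. lookup (homogenize d n \<mu>) j) = (\<Sum>j<d. lookup \<mu> j) + (n - (\<Sum>j<d. lookup \<mu> j))"
  using assms by (simp add: lessThan_Suc_atMost[symmetric] lookup_homogenize_last)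

lemma homogenize_in_exponents_iff:
  assumes "keys \<mu> \<subseteq> {..<d}"
  shows "homogenize d n \<mu> \<in> exponents d n \<longleftrightarrow> \<mu> \<in> parameter_exponents d n"
  using assms sum_homogenize[OF assms, of n] keys_homogenize[OF assms, of n]
  by (auto simp: exponents_def parameter_exponents_def)

lemma homogenize_surj:
  assumes "m \<in> exponents d n"
  obtains \<mu> where "\<mu> \<in> parameter_exponents d n" "m = homogenize d n \<mu>"
proof
  define \<mu> where "\<mu> = Poly_Mapping.update d 0 m"
  have lk: "lookup \<mu> j = (if j = d then 0 else lookup m j)" for j
    by (simp add: \<mu>_def lookup_update)
  have m: "keys m \<subseteq> {..d}" "(\<Sum>j<d. lookup m j) + lookup m d = n"
    using assms by (simp_all add: exponents_def lessThan_Suc_atMost[symmetric])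
  have sum: "(\<Sum>j<d. lookup \<mu> j) = (\<Sum>j<d. lookup m j)"
    by (intro sum.cong) (auto simp: lk)
  have "keys \<mu> \<subseteq> {..<d}"
  proof
    fix j assume "j \<in> keys \<mu>"
    then have "j \<noteq> d" "j \<in> keys m"
      by (auto simp: in_keys_iff lk split: if_splits)
    then show "j \<in> {..<d}"
      using m(1) by fastforce
  qed
  then show "\<mu> \<in> parameter_exponents d n"
    using m(2) by (simp add: parameter_exponents_def sum)
  show "m = homogenize d n \<mu>"
    using m(2) by (intro poly_mapping_eqI)
      (auto simp: homogenize_def lookup_add lookup_single lk sum when_def)
qed

text \<open>
  Exponents that differ do so at an index below \<open>d\<close>, and the added entry at \<open>d\<close> is less significant.
\<close>

lemma homogenize_strict_mono:
  assumes "\<mu> < \<mu>'" "keys \<mu> \<subseteq> {..<d}" "keys \<mu>' \<subseteq> {..<d}"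
  shows "homogenize d n \<mu> < homogenize d n \<mu>'"
proof -
  obtain k where k: "lookup \<mu> k < lookup \<mu>' k" "\<forall>k'<k. lookup \<mu> k' = lookup \<mu>' k'"
    using assms(1) by (auto simp: less_iff_lex)
  then have "k \<in> keys \<mu>'"
    by (simp add: in_keys_iff)
  then have "k < d"
    using assms(3) by auto
  with k show ?thesis
    unfolding less_iff_lex by (intro exI[of _ k]) simp
qed

lemma inj_on_homogenize: "inj_on (homogenize d n) {\<mu>. keys \<mu> \<subseteq> {..<d}}"
  by (rule inj_onI) (metis homogenize_strict_mono linorder_less_linear mem_Collect_eq order_less_irrefl)

section \<open>Order and leading coefficient in a basis adapted to a point\<close>

locale adapted_frame =
  fixes d :: nat and x :: "nat \<Rightarrow> complex" and Y :: "nat \<Rightarrow> mpol"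
  assumes x: "x \<in> proj_coords d"
    and inj: "inj_on Y {..d}"
    and indep: "mpol.independent (Y ` {..d})"
    and basis: "mpol.span (Y ` {..d}) = sections d 1"
    and vanishing: "\<And>j. j < d \<Longrightarrow> peval (Y j) x = 0"
begin

lemma Y_in_sections: "j \<le> d \<Longrightarrow> Y j \<in> sections d 1"
  unfolding basis[symmetric] by (intro mpol.span_base) simp

lemma psubst_Y_surj:
  assumes "p \<in> sections d 1"
  shows "\<exists>e\<in>sections d 1. psubst Y e = p"
proof -
  obtain u where "p = (\<Sum>v\<in>Y ` {..d}. pscale (u v) v)"
    using assms unfolding basis[symmetric] by (auto simp: mpol.span_finite)
  then have "psubst Y (\<Sum>j\<le>d. pscale (u (Y j)) (var j)) = p"
    by (simp add: mpol_subst.ev_sum mpol_subst.ev_scalar[folded pscale_eq_mult] sum.reindex[OF inj])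
  moreover have "(\<Sum>j\<le>d. pscale (u (Y j)) (var j)) \<in> sections d 1"
    by (intro sections_sum sections_pscale var_in_sections) simp
  ultimately show ?thesis
    by blast
qed

lemma psubst_Y_eq_0D:
  assumes e: "e \<in> sections d 1" "psubst Y e = 0"
  shows "e = 0"
proof (rule poly_mapping_eqI)
  fix m
  have "(\<Sum>v\<in>Y ` {..d}. pscale (form_coeff e (inv_into {..d} Y v)) v) = 0"
    using e by (simp add: sum.reindex[OF inj] inv_into_f_f[OF inj] psubst_form)
  then have "form_coeff e j = 0" if "j \<le> d" for j
    using mpol.independentD[OF indep, of "Y ` {..d}" "\<lambda>v. form_coeff e (inv_into {..d} Y v)" "Y j"] that
    by (simp add: inv_into_f_f[OF inj])
  then show "lookup e m = lookup 0 m"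
  proof (cases "m \<in> exponents d 1")
    case True
    then show ?thesis
      using \<open>\<And>j. j \<le> d \<Longrightarrow> form_coeff e j = 0\<close> unfolding exponents_1 by auto
  next
    case False
    then show ?thesis
      using e(1) by (auto simp: sections_eq in_keys_iff)
  qed
qed

text \<open>
  The linear form in variables standing for \<open>Y 0, \<dots>, Y d\<close> that expresses the coordinate \<open>X\<^sub>i\<close>, that
  is, a row of the inverse of the matrix of \<open>Y\<close>.
\<close>

definition coord :: "nat \<Rightarrow> mpol" where
  "coord i = (SOME e. e \<in> sections d 1 \<and> psubst Y e = var i)"

lemma coord:
  assumes "i \<le> d"
  shows "coord i \<in> sections d 1" "psubst Y (coord i) = var i"
proof -
  have "\<exists>e. e \<in> sections d 1 \<and> psubst Y e = var i"
    using psubst_Y_surj[OF var_in_sections[OF assms]] by blast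
  from someI_ex[OF this] show "coord i \<in> sections d 1" "psubst Y (coord i) = var i"
    unfolding coord_def by blast+
qed

text \<open>
  A left inverse of a square matrix is a right inverse: substituting \<open>Y\<close> into \<open>psubst coord (Y j)\<close>
  gives \<open>Y j\<close> back, and \<open>psubst Y\<close> is injective on linear forms since the \<open>Y j\<close> are independent.
\<close>

lemma psubst_coord_Y:
  assumes "j \<le> d"
  shows "psubst coord (Y j) = var j"
proof -
  let ?e = "psubst coord (Y j)"
  have "?e \<in> sections d 1"
    using coord(1) Y_in_sections[OF assms] by (rule psubst_in_sections)
  then have diff: "?e - var j \<in> sections d 1"
    using var_in_sections[OF assms] by (rule sections_diff)
  have "psubst Y ?e = psubst var (Y j)"
    unfolding psubst_psubst using Y_in_sections[OF assms] coord(2) by (rule mpol_subst.ev_cong)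
  then have "psubst Y (?e - var j) = 0"
    by (simp add: mpol_subst.ev_diff psubst_var)
  from psubst_Y_eq_0D[OF diff this] show ?thesis
    by (rule eq_iff_diff_eq_0[THEN iffD2])
qed

text \<open>
  The polynomial whose coefficients are those of \<open>s\<close> as a combination of monomials in \<open>Y\<close>.
\<close>

definition frame_coeffs :: "mpol \<Rightarrow> mpol" where
  "frame_coeffs s = psubst coord s"

lemma frame_coeffs_in_sections: "s \<in> sections d n \<Longrightarrow> frame_coeffs s \<in> sections d n"
  unfolding frame_coeffs_def using coord(1) by (rule psubst_in_sections)

lemma psubst_Y_frame_coeffs:
  assumes "s \<in> sections d n"
  shows "psubst Y (frame_coeffs s) = s"
proof -
  have "psubst Y (frame_coeffs s) = psubst var s"
    unfolding frame_coeffs_def psubst_psubst using assms coord(2) by (rule mpol_subst.ev_cong)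
  then show ?thesis by (simp add: psubst_var)
qed

lemma frame_coeffs_psubst_Y:
  assumes "a \<in> sections d n"
  shows "frame_coeffs (psubst Y a) = a"
proof -
  have "frame_coeffs (psubst Y a) = psubst var a"
    unfolding frame_coeffs_def psubst_psubst using assms psubst_coord_Y by (rule mpol_subst.ev_cong)
  then show ?thesis by (simp add: psubst_var)
qed

lemma peval_Y_solve:
  "\<exists>y. (\<forall>j\<le>d. peval (Y j) y = v j) \<and> (\<forall>i\<le>d. y i = peval (coord i) v) \<and> (\<forall>i>d. y i = x i)"
proof -
  define y where "y i = (if i \<le> d then peval (coord i) v else x i)" for i
  have "peval (Y j) y = v j" if "j \<le> d" for j
  proof -
    have "peval (Y j) y = peval (psubst coord (Y j)) v"
      unfolding peval_psubst using Y_in_sections[OF that] by (rule peval_cong) (simp add: y_def)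
    then show ?thesis
      using that by (simp add: psubst_coord_Y)
  qed
  then show ?thesis
    by (intro exI[of _ y]) (simp add: y_def)
qed

lemma peval_coord_x: "i \<le> d \<Longrightarrow> peval (coord i) (\<lambda>j. peval (Y j) x) = x i"
  using arg_cong[OF coord(2), of i "\<lambda>p. peval p x"] by (simp add: peval_psubst)

text \<open>
  Otherwise all linear forms would vanish at \<open>x\<close>, and hence all its coordinates.
\<close>

lemma peval_last_neq_0: "peval (Y d) x \<noteq> 0"
proof
  assume "peval (Y d) x = 0"
  then have zero: "peval (Y j) x = 0" if "j \<le> d" for j
    using vanishing that by (cases "j = d") auto
  have "x i = 0" if "i \<le> d" for i
  proof -
    have "x i = peval (coord i) (\<lambda>j. peval (Y j) x)"
      using that by (simp add: peval_coord_x)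
    also have "\<dots> = 0"
      using coord(1)[OF that] zero by (simp add: peval_form)
    finally show ?thesis .
  qed
  then show False
    using x by (auto simp: proj_coords_def)
qed

abbreviation param :: "nat \<Rightarrow> (nat \<Rightarrow> complex) \<Rightarrow> complex" where
  "param \<equiv> \<lambda>j y. peval (Y j) y / peval (Y d) y"

text \<open>
  Points with prescribed values of the \<open>Y j\<close> are given by the inverse matrix and depend continuously
  on these values; the value of \<open>Y d\<close> is kept fixed.  A sequence of tori shrinking to the origin on which a value is missed
  would yield points tending to \<open>x\<close> that violate \<open>P\<close>.
\<close>

lemma param_onto:
  assumes P: "eventually P (nhds x)"
  shows "\<exists>\<epsilon>>0. \<forall>z. (\<forall>j<d. cmod (z j) = \<epsilon>) \<longrightarrow> (\<exists>y. P y \<and> (\<forall>j<d. param j y = z j))"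
proof (rule ccontr)
  assume contr: "\<not> ?thesis"
  have "\<exists>z. (\<forall>j<d. cmod (z j) = 1 / real (Suc n)) \<and> \<not> (\<exists>y. P y \<and> (\<forall>j<d. param j y = z j))" for n
    using contr by (metis divide_pos_pos of_nat_0_less_iff zero_less_Suc zero_less_one)
  then obtain z where z: "\<And>n j. j < d \<Longrightarrow> cmod (z n j) = 1 / real (Suc n)"
    "\<And>n y. P y \<Longrightarrow> \<not> (\<forall>j<d. param j y = z n j)"
    by metis
  \<comment> \<open>The prescribed values of the \<open>Y j\<close>; they force the parameters to equal \<open>z n\<close>.\<close>
  define v where "v n j = (if j < d then z n j * peval (Y d) x else if j = d then peval (Y d) x else peval (Y j) x)" for n j
  obtain y where y: "\<And>n j. j \<le> d \<Longrightarrow> peval (Y j) (y n) = v n j"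
    "\<And>n i. i \<le> d \<Longrightarrow> y n i = peval (coord i) (v n)" "\<And>n i. i > d \<Longrightarrow> y n i = x i"
    using peval_Y_solve[of "v _"] by metis
  have v_lim: "(\<lambda>n. v n j) \<longlonglongrightarrow> peval (Y j) x" for j
  proof (cases "j < d")
    case True
    have "(\<lambda>n. z n j) \<longlonglongrightarrow> 0"
      by (rule tendsto_norm_zero_cancel) (use True z(1) LIMSEQ_inverse_real_of_nat in \<open>simp add: inverse_eq_divide\<close>)
    then have "(\<lambda>n. z n j * peval (Y d) x) \<longlonglongrightarrow> 0 * peval (Y d) x"
      by (intro tendsto_intros)
    then show ?thesis
      using True by (simp add: v_def vanishing)
  qed (auto simp: v_def)
  have "(\<lambda>n. y n i) \<longlonglongrightarrow> x i" for i
  proof (cases "i \<le> d")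
    case True
    then show ?thesis
      using tendsto_peval[of v, OF v_lim, of "coord i"] by (simp add: y(2) peval_coord_x)
  qed (simp add: y(3))
  then have "y \<longlonglongrightarrow> x"
    by (simp add: tendsto_fun_iff)
  with P have "eventually (\<lambda>n. P (y n)) sequentially"
    by (simp add: filterlim_iff)
  then obtain n where "P (y n)"
    by (meson eventually_sequentially order_refl)
  moreover have "param j (y n) = z n j" if "j < d" for j
    using that peval_last_neq_0 by (simp add: y(1) v_def)
  ultimately show False
    using z(2) by blast
qed

text \<open>
  The identity of polynomials \<open>s = (\<Sum>m. a m Y\<^sup>m)\<close>, divided by \<open>Y d ^ n\<close>, is an expansion of \<open>s\<close> wherever
  \<open>Y d\<close> does not vanish; by uniqueness it is the expansion.
\<close>

lemma expansion_eq:
  assumes s: "s \<in> sections d n"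
  shows "expansion d x (Y d) param n s
    = (\<lambda>\<mu>. if keys \<mu> \<subseteq> {..<d} then lookup (frame_coeffs s) (homogenize d n \<mu>) else 0)"
    (is "_ = ?e")
proof -
  define a where "a = frame_coeffs s"
  define B where "B = {\<mu> :: nat \<Rightarrow>\<^sub>0 nat. keys \<mu> \<subseteq> {..<d}}"
  have a: "a \<in> sections d n"
    using s by (simp add: a_def frame_coeffs_in_sections)
  have e: "((\<lambda>\<mu>. ?e \<mu> * (\<Prod>j<d. param j y ^ lookup \<mu> j)) has_sum (peval s y / peval (Y d) y ^ n)) B"
    if y: "peval (Y d) y \<noteq> 0" for y
  proof -
    define v where "v j = peval (Y j) y" for j
    have "((\<lambda>m. lookup a m * (\<Prod>j\<le>d. v j ^ lookup m j)) has_sum peval a v) {m. keys m \<subseteq> {..d}}"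
      using a by (intro peval_has_sum) (auto simp: sections_eq exponents_def)
    also have "peval a v = peval s y"
      using arg_cong[OF psubst_Y_frame_coeffs[OF s], of "\<lambda>p. peval p y"]
      unfolding a_def v_def by (simp only: peval_psubst)
    also have "((\<lambda>m. lookup a m * (\<Prod>j\<le>d. v j ^ lookup m j)) has_sum peval s y) {m. keys m \<subseteq> {..d}}
        \<longleftrightarrow> ((\<lambda>m. lookup a m * (\<Prod>j\<le>d. v j ^ lookup m j)) has_sum peval s y) (homogenize d n ` B)"
    proof (rule has_sum_cong_neutral)
      fix m assume "m \<in> {m. keys m \<subseteq> {..d}} - homogenize d n ` B"
      then have "m \<notin> exponents d n"
        by (auto simp: B_def parameter_exponents_def elim: homogenize_surj)
      then have "lookup a m = 0"
        using a by (auto simp: sections_eq in_keys_iff)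
      then show "lookup a m * (\<Prod>j\<le>d. v j ^ lookup m j) = 0"
        by simp
    qed (use keys_homogenize in \<open>auto simp: B_def\<close>)
    also have "\<dots> \<longleftrightarrow> (((\<lambda>m. lookup a m * (\<Prod>j\<le>d. v j ^ lookup m j)) \<circ> homogenize d n) has_sum peval s y) B"
      unfolding B_def by (rule has_sum_reindex[OF inj_on_homogenize])
    finally have "((\<lambda>\<mu>. (lookup a (homogenize d n \<mu>) * (\<Prod>j\<le>d. v j ^ lookup (homogenize d n \<mu>) j)) / v d ^ n)
        has_sum (peval s y / v d ^ n)) B"
      unfolding o_def by (rule has_sum_divide_const)
    also have "?this \<longleftrightarrow> ((\<lambda>\<mu>. ?e \<mu> * (\<Prod>j<d. param j y ^ lookup \<mu> j)) has_sum (peval s y / v d ^ n)) B"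
    proof (rule has_sum_cong)
      fix \<mu> assume "\<mu> \<in> B"
      then have \<mu>: "keys \<mu> \<subseteq> {..<d}"
        by (simp add: B_def)
      show "(lookup a (homogenize d n \<mu>) * (\<Prod>j\<le>d. v j ^ lookup (homogenize d n \<mu>) j)) / v d ^ n
          = ?e \<mu> * (\<Prod>j<d. param j y ^ lookup \<mu> j)"
      proof (cases "\<mu> \<in> parameter_exponents d n")
        case True
        then have le: "(\<Sum>j<d. lookup \<mu> j) \<le> n"
          by (simp add: parameter_exponents_def)
        have "(\<Prod>j\<le>d. v j ^ lookup (homogenize d n \<mu>) j)
            = (\<Prod>j<d. v j ^ lookup \<mu> j) * v d ^ (n - (\<Sum>j<d. lookup \<mu> j))"
          by (simp add: lessThan_Suc_atMost[symmetric] lookup_homogenize_last[OF \<mu>])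
        also have "\<dots> = (\<Prod>j<d. param j y ^ lookup \<mu> j) * v d ^ n"
          using y le by (simp add: v_def power_diff power_divide prod_dividef power_sum)
        finally show ?thesis
          using \<mu> y by (simp add: a_def v_def)
      next
        case False
        then have "homogenize d n \<mu> \<notin> exponents d n"
          using homogenize_in_exponents_iff[OF \<mu>] by blast
        then have "lookup a (homogenize d n \<mu>) = 0"
          using a by (auto simp: sections_eq in_keys_iff)
        then show ?thesis
          by (simp add: a_def)
      qed
    qed
    finally show ?thesis
      by (simp add: v_def)
  qed
  have "open {y. peval (Y d) y \<noteq> 0}"
    by (intro open_Collect_neq continuous_peval continuous_on_const)
  then have "\<forall>\<^sub>F y in nhds x. peval (Y d) y \<noteq> 0"
    using peval_last_neq_0 by (auto simp: eventually_nhds)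
  then have "is_expansion d x (Y d) param n s ?e"
    unfolding is_expansion_def using e by (auto simp: B_def elim!: eventually_mono)
  then show ?thesis
    unfolding expansion_def by (intro the_equality expansion_unique[OF param_onto]) auto
qed

lemma ord_lead_if_lowest_term:
  assumes s: "s \<in> sections d n" and \<mu>: "\<mu> \<in> parameter_exponents d n"
    and low: "has_lowest_term (frame_coeffs s) (homogenize d n \<mu>) c" and c: "c \<noteq> 0"
  shows "ord_sec d x (Y d) param n s = \<mu>" "lead_sec d x (Y d) param n s = c"
proof -
  have keys: "keys \<mu> \<subseteq> {..<d}"
    using \<mu> by (simp add: parameter_exponents_def)
  have e_\<mu>: "expansion d x (Y d) param n s \<mu> = c"
    using low keys by (simp add: expansion_eq[OF s] has_lowest_term_def)
  have "\<mu> \<le> \<mu>'" if "expansion d x (Y d) param n s \<mu>' \<noteq> 0" for \<mu>'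
  proof (rule ccontr)
    assume "\<not> \<mu> \<le> \<mu>'"
    then have "homogenize d n \<mu>' < homogenize d n \<mu>"
      using that keys by (intro homogenize_strict_mono) (auto simp: expansion_eq[OF s] split: if_splits)
    then show False
      using that low by (auto simp: expansion_eq[OF s] has_lowest_term_def split: if_splits)
  qed
  then show "ord_sec d x (Y d) param n s = \<mu>"
    unfolding ord_sec_def using e_\<mu> c by (intro Least_equality) auto
  then show "lead_sec d x (Y d) param n s = c"
    using e_\<mu> by (simp add: lead_sec_def)
qed

lemma ord_lead_lowest_term:
  assumes s: "s \<in> sections d n" "s \<noteq> 0"
  shows "ord_sec d x (Y d) param n s \<in> parameter_exponents d n"
    and "has_lowest_term (frame_coeffs s) (homogenize d n (ord_sec d x (Y d) param n s))
      (lead_sec d x (Y d) param n s)"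
    and "lead_sec d x (Y d) param n s \<noteq> 0"
proof -
  have "frame_coeffs s \<noteq> 0"
    using psubst_Y_frame_coeffs[OF s(1)] s(2) by auto
  then obtain m where m: "m \<in> keys (frame_coeffs s)"
    "has_lowest_term (frame_coeffs s) m (lookup (frame_coeffs s) m)"
    by (rule ex_lowest_term)
  then have "m \<in> exponents d n"
    using frame_coeffs_in_sections[OF s(1)] by (auto simp: sections_eq)
  then obtain \<mu> where \<mu>: "\<mu> \<in> parameter_exponents d n" "m = homogenize d n \<mu>"
    by (rule homogenize_surj)
  note * = ord_lead_if_lowest_term[OF s(1) \<mu>(1) m(2)[unfolded \<mu>(2)]]
  show "ord_sec d x (Y d) param n s \<in> parameter_exponents d n"
    "has_lowest_term (frame_coeffs s) (homogenize d n (ord_sec d x (Y d) param n s))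
      (lead_sec d x (Y d) param n s)" "lead_sec d x (Y d) param n s \<noteq> 0"
    using * m \<mu> by (simp_all add: in_keys_iff)
qed

text \<open>
  The monomial in \<open>Y\<close> with exponent \<open>homogenize d n \<mu>\<close> has order \<open>\<mu>\<close>.
\<close>

lemma ord_set_eq: "ord_set d x (Y d) param n = parameter_exponents d n"
proof
  show "ord_set d x (Y d) param n \<subseteq> parameter_exponents d n"
    using ord_lead_lowest_term(1) by (auto simp: ord_set_def)
  show "parameter_exponents d n \<subseteq> ord_set d x (Y d) param n"
  proof
    fix \<mu> assume \<mu>: "\<mu> \<in> parameter_exponents d n"
    define a :: mpol where "a = Poly_Mapping.single (homogenize d n \<mu>) 1"
    have a: "a \<in> sections d n"
      unfolding a_def using \<mu> homogenize_in_exponents_iff[of \<mu> d n]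
      by (intro sections_single) (auto simp: parameter_exponents_def)
    have s: "psubst Y a \<in> sections d n"
      using Y_in_sections a by (rule psubst_in_sections)
    have "has_lowest_term (frame_coeffs (psubst Y a)) (homogenize d n \<mu>) 1"
      unfolding frame_coeffs_psubst_Y[OF a] has_lowest_term_iff_single_add
      by (intro exI[of _ 0]) (simp add: a_def)
    then have "ord_sec d x (Y d) param n (psubst Y a) = \<mu>"
      using ord_lead_if_lowest_term(1)[OF s \<mu>] by simp
    moreover have "psubst Y a \<noteq> 0"
    proof
      assume "psubst Y a = 0"
      then have "a = 0"
        using frame_coeffs_psubst_Y[OF a] by (simp add: frame_coeffs_def)
      then have "keys a = {}"
        by simp
      then show False
        by (simp add: a_def)
    qed
    ultimately show "\<mu> \<in> ord_set d x (Y d) param n"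
      using s by (auto simp: ord_set_def)
  qed
qed

end

section \<open>Passage to the orthonormal basis\<close>

lemma form_inner_diff_left: "form_inner d (p - q) r = form_inner d p r - form_inner d q r"
  by (simp add: form_inner_def lookup_minus left_diff_distrib sum_subtractf)

lemma form_inner_add_left: "form_inner d (p + q) r = form_inner d p r + form_inner d q r"
  by (simp add: form_inner_def lookup_add distrib_right sum.distrib)

lemma form_inner_scale_left: "form_inner d (pscale c p) r = c * form_inner d p r"
  by (simp add: form_inner_def lookup_pscale sum_distrib_left mult.assoc)

lemma form_inner_scale_right: "form_inner d p (pscale c r) = cnj c * form_inner d p r"
  by (simp add: form_inner_def lookup_pscale sum_distrib_left ac_simps)

lemma form_inner_sum_left: "form_inner d (\<Sum>i\<in>I. p i) r = (\<Sum>i\<in>I. form_inner d (p i) r)"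
  by (induction I rule: infinite_finite_induct) (simp_all add: form_inner_add_left, simp_all add: form_inner_def)

lemma form_inner_commute: "form_inner d q p = cnj (form_inner d p q)"
  by (simp add: form_inner_def mult.commute)

lemma form_inner_self: "form_inner d p p = of_real (\<Sum>i\<le>d. (cmod (form_coeff p i))\<^sup>2)"
  unfolding form_inner_def of_real_sum complex_norm_square ..

lemma form_inner_self_pos:
  assumes "p \<in> sections d 1" "p \<noteq> 0"
  obtains \<nu> where "\<nu> > 0" "form_inner d p p = of_real (\<nu>\<^sup>2)"
proof
  obtain m where m: "m \<in> keys p"
    using assms(2) by (rule ex_lowest_term)
  then obtain i where "i \<le> d" "m = Poly_Mapping.single i 1"
    using assms(1) unfolding sections_eq exponents_1 by blast
  then have "form_coeff p i \<noteq> 0"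
    using m by (simp add: in_keys_iff)
  then have pos: "(\<Sum>i\<le>d. (cmod (form_coeff p i))\<^sup>2) > 0"
    using \<open>i \<le> d\<close> by (intro sum_pos2[of _ i]) auto
  then show "sqrt (\<Sum>i\<le>d. (cmod (form_coeff p i))\<^sup>2) > 0"
    by simp
  show "form_inner d p p = of_real ((sqrt (\<Sum>i\<le>d. (cmod (form_coeff p i))\<^sup>2))\<^sup>2)"
    using pos unfolding form_inner_self by simp
qed

context adapted_frame begin

definition U :: "nat \<Rightarrow> mpol" where
  "U = gram_schmidt d Y"

definition gs_coeff :: "nat \<Rightarrow> real" where
  "gs_coeff j = Re (form_inner d (Y j) (U j))"

text \<open>
  Besides orthonormality and triangularity, the induction carries along that \<open>U j\<close> lies in the span of
  \<open>Y 0, \<dots>, Y j\<close>: by independence of \<open>Y\<close>, the vector to be normalized in the next step is then nonzero.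
\<close>

lemma gram_schmidt_step:
  assumes "j \<le> d"
  shows "U j \<in> mpol.span (Y ` {..j}) \<and> form_inner d (U j) (U j) = 1 \<and>
    (\<forall>k<j. form_inner d (U j) (U k) = 0) \<and>
    gs_coeff j > 0 \<and> form_inner d (Y j) (U j) = of_real (gs_coeff j) \<and>
    Y j = pscale (of_real (gs_coeff j)) (U j) + (\<Sum>k<j. pscale (form_inner d (Y j) (U k)) (U k))"
  using assms
proof (induction j rule: less_induct)
  case (less j)
  have span_U: "U k \<in> mpol.span (Y ` {..k})" and unit_U: "form_inner d (U k) (U k) = 1" if "k < j" for k
    using less.IH[OF that] less.prems that by auto
  have orth_U: "form_inner d (U l) (U k) = 0" if "l < j" "k < j" "l \<noteq> k" for k l
  proof (cases "k < l")
    case True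
    then show ?thesis
      using less.IH[of l] less.prems that by auto
  next
    case False
    then have "form_inner d (U k) (U l) = 0"
      using less.IH[of k] less.prems that by auto
    then show ?thesis
      by (subst form_inner_commute) simp
  qed
  define pr where "pr = (\<Sum>k<j. pscale (form_inner d (Y j) (U k)) (U k))"
  define w where "w = Y j - pr"
  have pr_span: "pr \<in> mpol.span (Y ` {..<j})"
    unfolding pr_def
  proof (intro mpol.span_sum mpol.span_scale)
    fix k assume "k \<in> {..<j}"
    then have "U k \<in> mpol.span (Y ` {..k})" "Y ` {..k} \<subseteq> Y ` {..<j}"
      using span_U by auto
    then show "U k \<in> mpol.span (Y ` {..<j})"
      using mpol.span_mono by blast
  qed
  have Yj_span: "Y j \<in> mpol.span (Y ` {..j})"
    by (intro mpol.span_base) simp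
  have pr_span': "pr \<in> mpol.span (Y ` {..j})"
    using pr_span mpol.span_mono[of "Y ` {..<j}" "Y ` {..j}"] by fastforce
  have w_span: "w \<in> mpol.span (Y ` {..j})"
    unfolding w_def using Yj_span pr_span' by (rule mpol.span_diff)
  have "mpol.span (Y ` {..j}) \<subseteq> mpol.span (Y ` {..d})"
    using less.prems by (intro mpol.span_mono) auto
  then have w_sec: "w \<in> sections d 1"
    using w_span basis by blast
  have "w \<noteq> 0"
  proof
    assume "w = 0"
    then have "Y j \<in> mpol.span (Y ` {..<j})"
      using pr_span by (simp add: w_def)
    moreover have "Y ` {..<j} \<subseteq> Y ` {..d} - {Y j}"
      using inj less.prems by (auto simp: inj_on_def)
    ultimately have "Y j \<in> mpol.span (Y ` {..d} - {Y j})"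
      using mpol.span_mono by blast
    then have "mpol.dependent (Y ` {..d})"
      unfolding mpol.dependent_def using less.prems by (intro bexI[of _ "Y j"]) auto
    then show False
      using indep by contradiction
  qed
  with w_sec obtain \<nu> where \<nu>: "\<nu> > 0" "form_inner d w w = of_real (\<nu>\<^sup>2)"
    by (rule form_inner_self_pos)
  have "U j = pscale (1 / csqrt (form_inner d w w)) w"
    unfolding U_def by (subst gram_schmidt.simps) (simp add: Let_def w_def pr_def U_def)
  moreover have "csqrt (form_inner d w w) = of_real \<nu>"
    using \<nu> by (simp add: csqrt_of_real_nonneg)
  ultimately have U_j: "U j = pscale (1 / of_real \<nu>) w"
    by simp
  have w_eq: "w = pscale (of_real \<nu>) (U j)"
    using \<nu>(1) by (intro poly_mapping_eqI) (simp add: U_j lookup_pscale)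
  have pr_U: "form_inner d pr (U k) = form_inner d (Y j) (U k)" if "k < j" for k
  proof -
    have "form_inner d pr (U k) = (\<Sum>l<j. form_inner d (Y j) (U l) * form_inner d (U l) (U k))"
      by (simp add: pr_def form_inner_sum_left form_inner_scale_left)
    also have "\<dots> = (\<Sum>l\<in>{k}. form_inner d (Y j) (U k))"
      by (rule sum.mono_neutral_cong_right) (use that orth_U unit_U in auto)
    finally show ?thesis by simp
  qed
  have orth: "form_inner d (U j) (U k) = 0" if "k < j" for k
    unfolding U_j form_inner_scale_left w_def form_inner_diff_left pr_U[OF that] by simp
  have unit: "form_inner d (U j) (U j) = 1"
    unfolding U_j form_inner_scale_left form_inner_scale_right \<nu>(2)
    using \<nu>(1) by (simp add: power2_eq_square)
  have Y_j: "Y j = pscale (of_real \<nu>) (U j) + pr"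
    unfolding w_eq[symmetric] w_def by simp
  have "form_inner d pr (U j) = 0"
  proof -
    have "form_inner d (U l) (U j) = 0" if "l < j" for l
      using orth[OF that] by (subst form_inner_commute) simp
    then show ?thesis
      by (simp add: pr_def form_inner_sum_left form_inner_scale_left)
  qed
  moreover have "form_inner d (Y j) (U j) = of_real \<nu> * form_inner d (U j) (U j) + form_inner d pr (U j)"
    by (subst Y_j) (simp only: form_inner_add_left form_inner_scale_left)
  ultimately have YU: "form_inner d (Y j) (U j) = of_real \<nu>"
    by (simp add: unit)
  then have "gs_coeff j = \<nu>"
    by (simp add: gs_coeff_def)
  moreover have "U j \<in> mpol.span (Y ` {..j})"
    unfolding U_j using w_span by (rule mpol.span_scale)
  ultimately show ?case
    using orth unit Y_j YU \<nu>(1) by (auto simp: pr_def)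
qed

lemma gs_coeff_pos: "j \<le> d \<Longrightarrow> gs_coeff j > 0"
  and form_inner_Y_U: "j \<le> d \<Longrightarrow> form_inner d (Y j) (U j) = of_real (gs_coeff j)"
  and Y_triangular: "j \<le> d \<Longrightarrow> Y j = pscale (of_real (gs_coeff j)) (U j)
    + (\<Sum>k<j. pscale (form_inner d (Y j) (U k)) (U k))"
  using gram_schmidt_step by blast+

lemma U_in_sections:
  assumes "j \<le> d"
  shows "U j \<in> sections d 1"
proof -
  have "mpol.span (Y ` {..j}) \<subseteq> mpol.span (Y ` {..d})"
    using assms by (intro mpol.span_mono) auto
  then show ?thesis
    using gram_schmidt_step[OF assms] basis by blast
qed

lemma U_orthonormal:
  assumes "j \<le> d" "k \<le> d"
  shows "form_inner d (U j) (U k) = (if j = k then 1 else 0)"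
proof (cases j k rule: linorder_cases)
  case less
  then have "form_inner d (U k) (U j) = 0"
    using gram_schmidt_step[OF assms(2)] by blast
  then show ?thesis
    using less by (subst form_inner_commute) simp
qed (use gram_schmidt_step[OF assms(1)] in auto)

text \<open>
  \<open>Y j\<close> as a linear form in variables standing for \<open>U 0, \<dots>, U d\<close>.
\<close>

definition triangular_form :: "nat \<Rightarrow> mpol" where
  "triangular_form j = pscale (of_real (gs_coeff j)) (var j)
    + (\<Sum>k<j. pscale (form_inner d (Y j) (U k)) (var k))"

lemma psubst_U_triangular_form: "j \<le> d \<Longrightarrow> psubst U (triangular_form j) = Y j"
  by (subst Y_triangular)
     (simp_all add: triangular_form_def mpol_subst.ev_add mpol_subst.ev_sum
       mpol_subst.ev_scalar[folded pscale_eq_mult])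

lemma triangular_form_in_sections: "j \<le> d \<Longrightarrow> triangular_form j \<in> sections d 1"
  unfolding triangular_form_def
  by (intro sections_add sections_sum sections_pscale var_in_sections) auto

text \<open>
  The unit exponent at \<open>k\<close> grows as \<open>k\<close> decreases, so the diagonal entry of the triangular matrix is the
  lowest term.  This is where the order of the Gram-Schmidt process meets the lexicographic order.
\<close>

lemma has_lowest_term_triangular_form:
  "has_lowest_term (triangular_form j) (Poly_Mapping.single j 1) (of_real (gs_coeff j))"
proof -
  have less: "Poly_Mapping.single j 1 < Poly_Mapping.single k (1::nat)" if "k < j" for k
    unfolding less_iff_lex using that by (intro exI[of _ k]) (auto simp: lookup_single)
  have "keys (\<Sum>k<j. pscale (form_inner d (Y j) (U k)) (var k)) \<subseteq> {Poly_Mapping.single j 1<..}"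
  proof
    fix m assume "m \<in> keys (\<Sum>k<j. pscale (form_inner d (Y j) (U k)) (var k))"
    then have "(\<Sum>k<j. form_inner d (Y j) (U k) * lookup (var k) m) \<noteq> 0"
      by (simp add: in_keys_iff lookup_sum lookup_pscale)
    then obtain k where "k < j" "lookup (var k) m \<noteq> 0"
      by (metis (no_types, lifting) lessThan_iff mult_zero_right sum.neutral)
    then have "k < j" "m = Poly_Mapping.single k 1"
      by (auto simp: var_def lookup_single when_def split: if_splits)
    then show "m \<in> {Poly_Mapping.single j 1<..}"
      using less by simp
  qed
  moreover have "pscale (of_real (gs_coeff j)) (var j)
      = Poly_Mapping.single (Poly_Mapping.single j 1) (of_real (gs_coeff j))"
    by (simp add: var_def pscale_eq_mult mult_single)
  ultimately show ?thesis
    unfolding has_lowest_term_iff_single_add triangular_form_def by auto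
qed

text \<open>
  The polynomial whose coefficients are those of \<open>s\<close> as a combination of monomials in \<open>U\<close>.
\<close>

definition orthonormal_coeffs :: "mpol \<Rightarrow> mpol" where
  "orthonormal_coeffs s = psubst triangular_form (frame_coeffs s)"

lemma orthonormal_coeffs_in_sections:
  "s \<in> sections d n \<Longrightarrow> orthonormal_coeffs s \<in> sections d n"
  unfolding orthonormal_coeffs_def
  by (intro psubst_in_sections triangular_form_in_sections frame_coeffs_in_sections)

lemma psubst_U_orthonormal_coeffs:
  assumes "s \<in> sections d n"
  shows "psubst U (orthonormal_coeffs s) = s"
proof -
  have "psubst U (orthonormal_coeffs s) = psubst Y (frame_coeffs s)"
    unfolding orthonormal_coeffs_def psubst_psubst
    using frame_coeffs_in_sections[OF assms] psubst_U_triangular_form by (rule mpol_subst.ev_cong)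
  then show ?thesis
    by (simp add: psubst_Y_frame_coeffs[OF assms])
qed

lemma has_lowest_term_orthonormal_coeffs:
  assumes "s \<in> sections d n" "has_lowest_term (frame_coeffs s) m c"
  shows "has_lowest_term (orthonormal_coeffs s) m
    (c * power_product (\<lambda>j. of_real (gs_coeff j)) m)"
  unfolding orthonormal_coeffs_def
  by (intro has_lowest_term_psubst[OF has_lowest_term_triangular_form frame_coeffs_in_sections[OF assms(1)] assms(2)])

text \<open>
  The point at which the forms \<open>U j\<close> take the values \<open>v j\<close>: the inverse of a unitary matrix is its
  conjugate transpose.
\<close>

definition orthonormal_point :: "(nat \<Rightarrow> complex) \<Rightarrow> nat \<Rightarrow> complex" where
  "orthonormal_point v i = (\<Sum>j\<le>d. v j * cnj (form_coeff (U j) i))"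

lemma sum_mult_orthonormal_point: "(\<Sum>i\<le>d. c i * orthonormal_point v i) = (\<Sum>j\<le>d. v j * (\<Sum>i\<le>d. c i * cnj (form_coeff (U j) i)))"
proof -
  have "(\<Sum>i\<le>d. c i * orthonormal_point v i) = (\<Sum>i\<le>d. \<Sum>j\<le>d. v j * (c i * cnj (form_coeff (U j) i)))"
    by (simp add: orthonormal_point_def sum_distrib_left ac_simps)
  also have "\<dots> = (\<Sum>j\<le>d. \<Sum>i\<le>d. v j * (c i * cnj (form_coeff (U j) i)))"
    by (rule sum.swap)
  finally show ?thesis
    by (simp add: sum_distrib_left)
qed

lemma peval_U_orthonormal_point:
  assumes "k \<le> d"
  shows "peval (U k) (orthonormal_point v) = v k"
proof -
  have "peval (U k) (orthonormal_point v) = (\<Sum>j\<le>d. v j * form_inner d (U k) (U j))"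
    by (simp only: peval_form[OF U_in_sections[OF assms]] sum_mult_orthonormal_point form_inner_def)
  also have "\<dots> = (\<Sum>j\<in>{k}. v k)"
    by (rule sum.mono_neutral_cong_right) (use assms in \<open>auto simp: U_orthonormal\<close>)
  finally show ?thesis by simp
qed

lemma sum_cnj_mult_orthonormal_point:
  "(\<Sum>i\<le>d. cnj (y i) * orthonormal_point v i) = (\<Sum>j\<le>d. v j * cnj (peval (U j) y))"
  unfolding sum_mult_orthonormal_point
  by (intro sum.cong refl) (simp add: peval_form[OF U_in_sections] mult.commute)

lemma norm_orthonormal_point: "(\<Sum>i\<le>d. (cmod (orthonormal_point v i))\<^sup>2) = (\<Sum>j\<le>d. (cmod (v j))\<^sup>2)"
proof -
  have "complex_of_real (\<Sum>i\<le>d. (cmod (orthonormal_point v i))\<^sup>2) = (\<Sum>i\<le>d. cnj (orthonormal_point v i) * orthonormal_point v i)"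
    unfolding of_real_sum complex_norm_square by (simp add: mult.commute)
  also have "\<dots> = (\<Sum>j\<le>d. v j * cnj (v j))"
    unfolding sum_cnj_mult_orthonormal_point by (simp add: peval_U_orthonormal_point)
  also have "\<dots> = of_real (\<Sum>j\<le>d. (cmod (v j))\<^sup>2)"
    unfolding of_real_sum complex_norm_square ..
  finally show ?thesis
    by (simp only: of_real_eq_iff)
qed

text \<open>
  The square of the distance from \<open>y\<close> to \<open>orthonormal_point v\<close>, with \<open>v j\<close> the value of \<open>U j\<close> at \<open>y\<close>, is
  the difference of the two sides.
\<close>

lemma bessel: "(\<Sum>j\<le>d. (cmod (peval (U j) y))\<^sup>2) \<le> (\<Sum>i\<le>d. (cmod (y i))\<^sup>2)"
proof -
  define v where "v j = peval (U j) y" for j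
  define S where "S = (\<Sum>j\<le>d. (cmod (v j))\<^sup>2)"
  have S: "complex_of_real S = (\<Sum>j\<le>d. v j * cnj (v j))"
    unfolding S_def of_real_sum complex_norm_square ..
  have cross: "(\<Sum>i\<le>d. cnj (y i) * orthonormal_point v i) = of_real S"
    unfolding sum_cnj_mult_orthonormal_point S by (simp add: v_def)
  have "(cmod (y i - orthonormal_point v i))\<^sup>2
      = (cmod (y i))\<^sup>2 + (cmod (orthonormal_point v i))\<^sup>2 - 2 * Re (cnj (y i) * orthonormal_point v i)" for i
    unfolding cmod_power2 by (simp add: power2_eq_square algebra_simps)
  then have "(\<Sum>i\<le>d. (cmod (y i - orthonormal_point v i))\<^sup>2)
      = (\<Sum>i\<le>d. (cmod (y i))\<^sup>2) + (\<Sum>i\<le>d. (cmod (orthonormal_point v i))\<^sup>2) - 2 * Re (\<Sum>i\<le>d. cnj (y i) * orthonormal_point v i)"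
    by (simp add: sum.distrib sum_subtractf sum_distrib_left)
  also have "\<dots> = (\<Sum>i\<le>d. (cmod (y i))\<^sup>2) - S"
    unfolding cross by (simp add: norm_orthonormal_point S_def)
  finally have "(\<Sum>i\<le>d. (cmod (y i))\<^sup>2) - S = (\<Sum>i\<le>d. (cmod (y i - orthonormal_point v i))\<^sup>2)"
    by simp
  also have "\<dots> \<ge> 0"
    by (intro sum_nonneg) auto
  finally show ?thesis
    by (simp add: S_def v_def)
qed

lemma psubst_U_inj:
  assumes "a \<in> sections d n" "b \<in> sections d n" "psubst U a = psubst U b"
  shows "a = b"
proof -
  have eq: "peval p v = peval (psubst U p) (orthonormal_point v)" if "p \<in> sections d n" for p v
    unfolding peval_psubst using that by (rule peval_cong) (simp add: peval_U_orthonormal_point)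
  have "peval (a - b) v = 0" for v
    using eq[OF assms(1)] eq[OF assms(2)] assms(3)
    by (simp add: peval_eq_ev complex_eval.ev_diff)
  then have "a - b = 0"
    using section_eq_0_if_peval_eq_0[OF sections_diff[OF assms(1,2)]] by blast
  then show ?thesis
    by (rule eq_iff_diff_eq_0[THEN iffD2])
qed

end

section \<open>Supremum norms and the exact value of the leading supremum\<close>

lemma fs_metric_bdd_above:
  assumes "s \<in> sections d n"
  shows "bdd_above (fs_metric d n s ` proj_coords d)"
proof (rule bdd_aboveI2)
  fix y :: "nat \<Rightarrow> complex" assume y: "y \<in> proj_coords d"
  define R where "R = sqrt (\<Sum>i\<le>d. (cmod (y i))\<^sup>2)"
  obtain i where "i \<le> d" "y i \<noteq> 0"
    using y by (auto simp: proj_coords_def)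
  then have "(\<Sum>i\<le>d. (cmod (y i))\<^sup>2) > 0"
    by (intro sum_pos2[of _ i]) auto
  then have R: "R > 0"
    by (simp add: R_def)
  have y_le: "cmod (y i) \<le> R" if "i \<le> d" for i
    unfolding R_def using that by (intro real_le_rsqrt member_le_sum) auto
  have mono: "cmod (power_product y m) \<le> R ^ n" if "m \<in> keys s" for m
  proof -
    have m: "keys m \<subseteq> {..d}" "(\<Sum>i\<le>d. lookup m i) = n"
      using assms that by (auto simp: sections_eq exponents_def)
    have "cmod (power_product y m) = (\<Prod>i\<le>d. cmod (y i) ^ lookup m i)"
      by (simp add: power_product_superset[OF _ m(1)] prod_norm[symmetric] norm_power)
    also have "\<dots> \<le> (\<Prod>i\<le>d. R ^ lookup m i)"
      using y_le by (intro prod_mono) (auto intro!: power_mono)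
    also have "\<dots> = R ^ n"
      by (simp add: power_sum[symmetric] m(2))
    finally show ?thesis .
  qed
  have "cmod (peval s y) \<le> (\<Sum>m\<in>keys s. cmod (lookup s m) * R ^ n)"
    unfolding peval_eq_ev complex_eval.ev_def
    by (intro sum_norm_le) (auto simp: norm_mult intro!: mult_left_mono mono)
  then show "fs_metric d n s y \<le> (\<Sum>m\<in>keys s. cmod (lookup s m))"
    using R by (simp add: fs_metric_def R_def[symmetric] divide_le_eq sum_distrib_right)
qed

lemma peval_le_fs_sup_norm:
  assumes "s \<in> sections d n" "(\<Sum>i\<le>d. (cmod (y i))\<^sup>2) = 1"
  shows "cmod (peval s y) \<le> fs_sup_norm d n s"
proof -
  have "y \<in> proj_coords d"
  proof (rule ccontr)
    assume "y \<notin> proj_coords d"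
    then have "(\<Sum>i\<le>d. (cmod (y i))\<^sup>2) = 0"
      by (simp add: proj_coords_def)
    with assms(2) show False by simp
  qed
  then have "fs_metric d n s y \<le> fs_sup_norm d n s"
    unfolding fs_sup_norm_def using fs_metric_bdd_above[OF assms(1)] by (intro cSUP_upper)
  then show ?thesis
    by (simp add: fs_metric_def assms(2))
qed

text \<open>
  The weighted inequality of arithmetic and geometric means with weights \<open>k i / n\<close>, in the form that
  the left-hand side is maximal at \<open>p i = k i / n\<close>.  It follows factor by factor from
  \<open>q \<le> exp (q - 1)\<close> for the quotient \<open>q\<close> of \<open>p i\<close> and \<open>k i / n\<close>, as the exponents then add up to at
  most \<open>0\<close>.
\<close>

lemma weighted_amgm:
  fixes p :: "'i \<Rightarrow> real" and k :: "'i \<Rightarrow> nat"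
  assumes p: "\<And>i. i \<in> I \<Longrightarrow> p i \<ge> 0" "(\<Sum>i\<in>I. p i) \<le> 1"
    and k: "(\<Sum>i\<in>I. k i) = n" "n > 0"
  shows "(\<Prod>i\<in>I. p i ^ k i) \<le> (\<Prod>i\<in>I. (real (k i) / real n) ^ k i)"
proof -
  have factor: "p i ^ k i \<le> (real (k i) / real n) ^ k i * exp (real n * p i - real (k i))"
    if i: "i \<in> I" for i
  proof (cases "k i = 0")
    case True
    then show ?thesis using p(1)[OF i] by simp
  next
    case False
    define w where "w = real (k i) / real n"
    have w: "w > 0"
      using False k(2) by (simp add: w_def)
    have "p i / w \<le> exp (p i / w - 1)"
      using exp_ge_add_one_self[of "p i / w - 1"] by simp
    then have "p i \<le> w * exp (p i / w - 1)"
      using w by (simp add: divide_le_eq mult.commute)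
    then have "p i ^ k i \<le> (w * exp (p i / w - 1)) ^ k i"
      using p(1)[OF i] by (intro power_mono)
    also have "\<dots> = w ^ k i * exp (real (k i) * (p i / w - 1))"
      by (simp add: power_mult_distrib exp_of_nat_mult)
    also have "real (k i) * (p i / w - 1) = real n * p i - real (k i)"
      using False k(2) by (simp add: w_def field_simps)
    finally show ?thesis
      by (simp add: w_def)
  qed
  have fin: "finite I"
    using k by (metis not_gr0 sum.infinite)
  have "(\<Prod>i\<in>I. p i ^ k i)
      \<le> (\<Prod>i\<in>I. (real (k i) / real n) ^ k i * exp (real n * p i - real (k i)))"
    using factor p(1) by (intro prod_mono) auto
  also have "\<dots> = (\<Prod>i\<in>I. (real (k i) / real n) ^ k i) * exp (real n * (\<Sum>i\<in>I. p i) - real n)"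
    using fin k(1) by (simp add: prod.distrib exp_sum[symmetric] sum_subtractf sum_distrib_left flip: of_nat_sum)
  also have "\<dots> \<le> (\<Prod>i\<in>I. (real (k i) / real n) ^ k i) * 1"
    using mult_left_mono[OF p(2), of "real n"] by (intro mult_left_mono prod_nonneg) auto
  finally show ?thesis by simp
qed

text \<open>
  The norm of a monomial of degree \<open>n\<close> in an orthonormal basis, which is its value where the moduli of
  the coordinates are \<open>sqrt (m j / n)\<close>.  Here \<open>0 ^ 0 = 1\<close> takes care of variables that do not occur.
\<close>

definition monomial_norm :: "nat \<Rightarrow> nat \<Rightarrow> (nat \<Rightarrow>\<^sub>0 nat) \<Rightarrow> real" where
  "monomial_norm d n m = (\<Prod>j\<le>d. sqrt (real (lookup m j) / real n) ^ lookup m j)"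

lemma monomial_norm_pos: "n > 0 \<Longrightarrow> monomial_norm d n m > 0"
  unfolding monomial_norm_def by (intro prod_pos) (auto simp: zero_less_power_eq)

context adapted_frame begin

text \<open>
  The torus with radii \<open>sqrt (m j / n)\<close> is contained in the unit sphere because the entries of \<open>m\<close> sum
  to \<open>n\<close>; on the sphere the norm of \<open>s\<close> bounds its values.
\<close>

lemma orthonormal_coeff_le:
  assumes s: "s \<in> sections d n" and n: "n > 0" and m: "m \<in> exponents d n"
  shows "cmod (lookup (orthonormal_coeffs s) m) * monomial_norm d n m \<le> fs_sup_norm d n s"
  unfolding monomial_norm_def
proof (rule polynomial_cauchy_estimate[OF orthonormal_coeffs_in_sections[OF s] _ _ m])
  fix z :: "nat \<Rightarrow> complex"
  assume z: "\<And>j. j \<le> d \<Longrightarrow> cmod (z j) = sqrt (real (lookup m j) / real n)"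
  have "(\<Sum>i\<le>d. (cmod (orthonormal_point z i))\<^sup>2) = (\<Sum>j\<le>d. real (lookup m j) / real n)"
    unfolding norm_orthonormal_point by (intro sum.cong) (simp_all add: z)
  also have "\<dots> = real (\<Sum>j\<le>d. lookup m j) / real n"
    by (simp add: sum_divide_distrib)
  also have "\<dots> = 1"
    using m n by (simp add: exponents_def)
  finally have "cmod (peval s (orthonormal_point z)) \<le> fs_sup_norm d n s"
    by (intro peval_le_fs_sup_norm s)
  moreover have "peval s (orthonormal_point z) = peval (orthonormal_coeffs s) z"
  proof -
    have "peval s (orthonormal_point z) = peval (psubst U (orthonormal_coeffs s)) (orthonormal_point z)"
      by (simp add: psubst_U_orthonormal_coeffs[OF s])
    also have "\<dots> = peval (orthonormal_coeffs s) z"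
      unfolding peval_psubst using orthonormal_coeffs_in_sections[OF s]
      by (rule peval_cong) (simp add: peval_U_orthonormal_point)
    finally show ?thesis .
  qed
  ultimately show "cmod (peval (orthonormal_coeffs s) z) \<le> fs_sup_norm d n s"
    by simp
qed simp

lemma fs_sup_norm_monomial_le:
  assumes n: "n > 0" and m: "m \<in> exponents d n"
  shows "fs_sup_norm d n (power_product U m) \<le> monomial_norm d n m"
  unfolding fs_sup_norm_def
proof (rule cSUP_least)
  show "proj_coords d \<noteq> {}"
    using x by blast
  fix y assume y: "y \<in> proj_coords d"
  define R where "R = sqrt (\<Sum>i\<le>d. (cmod (y i))\<^sup>2)"
  obtain i where "i \<le> d" "y i \<noteq> 0"
    using y by (auto simp: proj_coords_def)
  then have pos: "(\<Sum>i\<le>d. (cmod (y i))\<^sup>2) > 0"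
    by (intro sum_pos2[of _ i]) auto
  then have R: "R > 0"
    by (simp add: R_def)
  define a where "a j = cmod (peval (U j) y) / R" for j
  have m_sum: "(\<Sum>j\<le>d. lookup m j) = n" "keys m \<subseteq> {..d}"
    using m by (simp_all add: exponents_def)
  have "cmod (peval (power_product U m) y) = (\<Prod>j\<le>d. cmod (peval (U j) y) ^ lookup m j)"
    unfolding peval_eq_ev complex_eval.ev_power_product
    by (simp add: power_product_superset[OF _ m_sum(2)] prod_norm[symmetric] norm_power)
  then have metric: "fs_metric d n (power_product U m) y = (\<Prod>j\<le>d. a j ^ lookup m j)"
    using m_sum(1)
    by (simp add: fs_metric_def R_def[symmetric] a_def power_divide prod_dividef flip: power_sum)
  have "(\<Sum>j\<le>d. (a j)\<^sup>2) = (\<Sum>j\<le>d. (cmod (peval (U j) y))\<^sup>2) / R\<^sup>2"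
    by (simp add: a_def power_divide sum_divide_distrib)
  also have "\<dots> \<le> 1"
    using bessel[of y] pos by (simp add: R_def divide_le_eq)
  finally have a_sum: "(\<Sum>j\<le>d. (a j)\<^sup>2) \<le> 1" .
  have "(\<Prod>j\<le>d. a j ^ lookup m j)\<^sup>2 = (\<Prod>j\<le>d. ((a j)\<^sup>2) ^ lookup m j)"
    by (simp add: prod_power_distrib power_mult[symmetric] mult.commute)
  also have "\<dots> \<le> (\<Prod>j\<le>d. (real (lookup m j) / real n) ^ lookup m j)"
    using a_sum m_sum(1) n by (intro weighted_amgm) auto
  also have "\<dots> = (monomial_norm d n m)\<^sup>2"
  proof -
    have "(sqrt q ^ k)\<^sup>2 = q ^ k" if "q \<ge> 0" for q :: real and k
      using that by (simp add: power2_eq_square flip: power_mult_distrib)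
    then show ?thesis
      by (simp add: monomial_norm_def prod_power_distrib)
  qed
  finally show "fs_metric d n (power_product U m) y \<le> monomial_norm d n m"
    unfolding metric using less_imp_le[OF monomial_norm_pos[OF n, of d m]] by (rule power2_le_imp_le)
qed

text \<open>
  The bound for all sections of order \<open>\<mu>\<close> is Cauchy's estimate; the section \<open>U\<^sup>m\<close> attains it.
\<close>

lemma lead_sup_eq:
  assumes n: "n > 0" and \<mu>: "\<mu> \<in> parameter_exponents d n"
  defines "m \<equiv> homogenize d n \<mu>"
  shows "lead_sup d x (Y d) param n \<mu>
    = 1 / ((\<Prod>j\<le>d. gs_coeff j ^ lookup m j) * monomial_norm d n m)"
proof -
  define G where "G = (\<Prod>j\<le>d. gs_coeff j ^ lookup m j)"
  define V where "V = monomial_norm d n m"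
  have m: "m \<in> exponents d n"
    using \<mu> homogenize_in_exponents_iff[of \<mu> d n] by (simp add: m_def parameter_exponents_def)
  have keys_m: "keys m \<subseteq> {..d}"
    using m by (simp add: exponents_def)
  have G: "G > 0"
    unfolding G_def using gs_coeff_pos by (intro prod_pos) auto
  have pp: "power_product (\<lambda>j. of_real (gs_coeff j)) m = complex_of_real G"
    by (simp add: G_def power_product_superset[OF _ keys_m])
  have V: "V > 0"
    using n by (simp add: V_def monomial_norm_pos)
  let ?ord = "ord_sec d x (Y d) param n" and ?lead = "lead_sec d x (Y d) param n"
  let ?S = "{s \<in> sections d n - {0}. ?ord s = \<mu>}"
  have le: "cmod (?lead s) / fs_sup_norm d n s \<le> 1 / (G * V)" if s: "s \<in> ?S" for s
  proof -
    have "has_lowest_term (orthonormal_coeffs s) m (?lead s * of_real G)"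
      using s ord_lead_lowest_term(2)[of s n]
      by (auto simp flip: pp intro!: has_lowest_term_orthonormal_coeffs simp: m_def)
    then have "lookup (orthonormal_coeffs s) m = ?lead s * of_real G"
      by (simp add: has_lowest_term_def)
    then have bound: "cmod (?lead s) * G * V \<le> fs_sup_norm d n s"
      using orthonormal_coeff_le[of s n m] s n m G by (simp add: V_def norm_mult)
    moreover have "cmod (?lead s) * G * V > 0"
      using ord_lead_lowest_term(3)[of s n] s G V by simp
    ultimately have "fs_sup_norm d n s > 0"
      by linarith
    then show ?thesis
      using bound G V by (simp add: field_simps)
  qed
  define s where "s = power_product U m"
  have s_sec: "s \<in> sections d n"
    unfolding s_def using U_in_sections m by (rule power_product_in_sections)
  have single: "Poly_Mapping.single m 1 \<in> sections d n"
    using m by (rule sections_single)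
  have "psubst U (Poly_Mapping.single m 1) = s"
    by (simp add: mpol_subst.ev_single s_def)
  then have coeffs_s: "orthonormal_coeffs s = Poly_Mapping.single m 1"
    using psubst_U_orthonormal_coeffs[OF s_sec]
    by (intro psubst_U_inj[OF orthonormal_coeffs_in_sections[OF s_sec] single]) simp
  have s_neq: "s \<noteq> 0"
  proof
    assume "s = 0"
    then have "keys (orthonormal_coeffs s) = {}"
      by (simp add: orthonormal_coeffs_def frame_coeffs_def)
    then show False
      by (simp add: coeffs_s)
  qed
  note ord_s = ord_lead_lowest_term[OF s_sec s_neq]
  define m' where "m' = homogenize d n (?ord s)"
  define G' where "G' = power_product (\<lambda>j. complex_of_real (gs_coeff j)) m'"
  have keys_ord: "keys (?ord s) \<subseteq> {..<d}"
    using ord_s(1) by (simp add: parameter_exponents_def)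
  have "keys m' \<subseteq> {..d}"
    unfolding m'_def using keys_ord by (rule keys_homogenize)
  moreover have "gs_coeff j \<noteq> 0" if "j \<le> d" for j
    using gs_coeff_pos[OF that] by simp
  ultimately have "G' \<noteq> 0"
    unfolding G'_def by (simp add: power_product_superset[of "{..d}"])
  \<comment> \<open>The order of \<open>s\<close> is read off from the only coefficient of \<open>s\<close> with respect to \<open>U\<close>: since
    \<open>G'\<close> is nonzero, the lowest exponent \<open>m'\<close> of its coefficients with respect to \<open>Y\<close> must be \<open>m\<close>.\<close>
  have "lookup (orthonormal_coeffs s) m' = ?lead s * G'"
    using has_lowest_term_orthonormal_coeffs[OF s_sec ord_s(2)]
    by (simp add: has_lowest_term_def m'_def G'_def)
  then have lk: "lookup (Poly_Mapping.single m (1::complex)) m' = ?lead s * G'"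
    by (simp add: coeffs_s)
  then have "m' = m"
    using ord_s(3) \<open>G' \<noteq> 0\<close> by (cases "m' = m") (auto simp: lookup_single)
  then have ord_eq: "?ord s = \<mu>"
    unfolding m'_def m_def
    by (rule inj_onD[OF inj_on_homogenize]) (use keys_ord \<mu> in \<open>simp_all add: parameter_exponents_def\<close>)
  have "?lead s * of_real G = 1"
    using lk unfolding G'_def \<open>m' = m\<close> pp by simp
  from arg_cong[OF this, of cmod] have "cmod (?lead s) * G = 1"
    using G by (simp add: norm_mult)
  then have lead_s: "cmod (?lead s) = 1 / G"
    using G by (simp add: field_simps)
  have s_in: "s \<in> ?S"
    using s_sec s_neq ord_eq by simp
  have "fs_sup_norm d n s \<le> V"
    unfolding s_def V_def by (rule fs_sup_norm_monomial_le[OF n m])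
  moreover have "1 * V \<le> fs_sup_norm d n s"
    using orthonormal_coeff_le[OF s_sec n m] by (simp add: coeffs_s V_def)
  ultimately have "fs_sup_norm d n s = V"
    by simp
  then have "cmod (?lead s) / fs_sup_norm d n s = 1 / (G * V)"
    using lead_s by simp
  then have "lead_sup d x (Y d) param n \<mu> = 1 / (G * V)"
    unfolding lead_sup_def
    using le s_in by (intro cSup_eq_maximum) (auto simp: image_iff intro!: bexI[of _ s])
  then show ?thesis
    by (simp add: G_def V_def)
qed

end

section \<open>The simplex and its rational points\<close>

lemma continuous_on_entropy_term: "continuous_on {0..} (\<lambda>b::real. b * ln (1 / b))"
  unfolding continuous_on_eq_continuous_within
proof
  fix b :: real assume b: "b \<in> {0..}"
  show "continuous (at b within {0..}) (\<lambda>b. b * ln (1 / b))"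
  proof (cases "b = 0")
    case True
    have "((\<lambda>b. ln (inverse b) / inverse b) \<longlongrightarrow> (0::real)) (at_right 0)"
      by (rule filterlim_compose[OF ln_x_over_x_tendsto_0 filterlim_inverse_at_top_right])
    then show ?thesis
      by (simp add: True continuous_within at_within_Ici_at_right divide_inverse mult.commute)
  next
    case False
    then have "isCont (\<lambda>b. b * ln (1 / b)) b"
      using b by (intro continuous_intros) auto
    then show ?thesis
      by (rule continuous_at_imp_continuous_at_within)
  qed
qed

text \<open>
  The convex hull of the origin and the first \<open>d\<close> unit vectors, which will be the Okounkov body.
\<close>

definition corner_simplex :: "nat \<Rightarrow> (nat \<Rightarrow> real) set" where
  "corner_simplex d = {\<alpha>. (\<forall>j<d. \<alpha> j \<ge> 0) \<and> (\<forall>j\<ge>d. \<alpha> j = 0) \<and> (\<Sum>j<d. \<alpha> j) \<le> 1}"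

definition barycentric :: "nat \<Rightarrow> (nat \<Rightarrow> real) \<Rightarrow> nat \<Rightarrow> real" where
  "barycentric d \<alpha> = \<alpha>(d := 1 - (\<Sum>j<d. \<alpha> j))"

lemma barycentric_nonneg: "\<alpha> \<in> corner_simplex d \<Longrightarrow> j \<le> d \<Longrightarrow> barycentric d \<alpha> j \<ge> 0"
  by (auto simp: corner_simplex_def barycentric_def)

lemma continuous_on_coordinate [continuous_intros]: "continuous_on A (\<lambda>\<alpha>. \<alpha> j :: real)"
  by (rule continuous_on_subset[OF continuous_on_product_coordinates]) simp

lemma continuous_on_barycentric: "continuous_on A (\<lambda>\<alpha>. barycentric d \<alpha> j)"
  by (cases "j = d") (auto simp: barycentric_def intro!: continuous_intros)

lemma Euclidean_space_eq: "Euclidean_space d = top_of_set {\<alpha>. \<forall>j\<ge>d. \<alpha> j = 0}"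
  by (simp add: Euclidean_space_def euclidean_product_topology)

lemma closed_corner_simplex: "closed (corner_simplex d)"
proof -
  have "corner_simplex d = (\<Inter>j\<in>{..<d}. {\<alpha>. 0 \<le> \<alpha> j}) \<inter> (\<Inter>j\<in>{d..}. {\<alpha>. \<alpha> j = 0})
      \<inter> {\<alpha>. (\<Sum>j<d. \<alpha> j) \<le> 1}"
    by (auto simp: corner_simplex_def)
  then show ?thesis
    by (auto intro!: closed_Int closed_INT closed_Collect_le closed_Collect_eq continuous_intros)
qed

lemma scaled_exponent_in_corner_simplex:
  assumes "\<mu> \<in> parameter_exponents d n"
  shows "scaled_exponent n \<mu> \<in> corner_simplex d"
proof -
  have "real (\<Sum>j<d. lookup \<mu> j) \<le> real n"
    using assms by (simp only: parameter_exponents_def of_nat_le_iff mem_Collect_eq)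
  then have "(\<Sum>j<d. scaled_exponent n \<mu> j) \<le> 1"
    by (cases "n = 0") (simp_all add: scaled_exponent_def sum_divide_distrib[symmetric] divide_le_eq)
  moreover have "lookup \<mu> j = 0" if "j \<ge> d" for j
    using assms that by (metis (no_types, lifting) in_keys_iff leD lessThan_iff mem_Collect_eq
      parameter_exponents_def subsetD)
  ultimately show ?thesis
    by (simp add: corner_simplex_def scaled_exponent_def)
qed

text \<open>
  Rounding down keeps the total degree at most \<open>n\<close>, so these exponents are orders of sections; they show
  that the limits taken at \<open>\<alpha>\<close> are not vacuous.
\<close>

definition floor_exponent :: "nat \<Rightarrow> (nat \<Rightarrow> real) \<Rightarrow> nat \<Rightarrow> (nat \<Rightarrow>\<^sub>0 nat)" where
  "floor_exponent d \<alpha> n = (\<Sum>j<d. Poly_Mapping.single j (nat \<lfloor>real n * \<alpha> j\<rfloor>))"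

lemma lookup_floor_exponent:
  "lookup (floor_exponent d \<alpha> n) j = (if j < d then nat \<lfloor>real n * \<alpha> j\<rfloor> else 0)"
proof -
  have "lookup (floor_exponent d \<alpha> n) j = (\<Sum>i<d. if i = j then nat \<lfloor>real n * \<alpha> i\<rfloor> else 0)"
    unfolding floor_exponent_def lookup_sum
    by (intro sum.cong refl) (simp add: lookup_single when_def)
  then show ?thesis
    by (simp add: sum.delta)
qed

lemma floor_exponent_in_parameter_exponents:
  assumes "\<alpha> \<in> corner_simplex d"
  shows "floor_exponent d \<alpha> n \<in> parameter_exponents d n"
proof -
  have "real (\<Sum>j<d. lookup (floor_exponent d \<alpha> n) j) \<le> (\<Sum>j<d. real n * \<alpha> j)"
    unfolding of_nat_sum using assms
    by (intro sum_mono) (auto simp: lookup_floor_exponent corner_simplex_def)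
  also have "\<dots> \<le> real n"
    using assms mult_left_mono[of "\<Sum>j<d. \<alpha> j" 1 "real n"]
    by (simp add: corner_simplex_def sum_distrib_left)
  finally have "(\<Sum>j<d. lookup (floor_exponent d \<alpha> n) j) \<le> n"
    by (simp only: of_nat_le_iff)
  moreover have "keys (floor_exponent d \<alpha> n) \<subseteq> {..<d}"
    by (auto simp: in_keys_iff lookup_floor_exponent split: if_splits)
  ultimately show ?thesis
    by (simp add: parameter_exponents_def)
qed

lemma scaled_floor_exponent_tendsto:
  assumes "\<alpha> \<in> corner_simplex d"
  shows "(\<lambda>n. scaled_exponent n (floor_exponent d \<alpha> n)) \<longlonglongrightarrow> \<alpha>"
  unfolding tendsto_fun_iff
proof
  fix j
  show "(\<lambda>n. scaled_exponent n (floor_exponent d \<alpha> n) j) \<longlonglongrightarrow> \<alpha> j"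
  proof (cases "j < d")
    case True
    then have nonneg: "\<alpha> j \<ge> 0"
      using assms by (simp add: corner_simplex_def)
    have eq: "scaled_exponent n (floor_exponent d \<alpha> n) j = of_int \<lfloor>real n * \<alpha> j\<rfloor> / real n" for n
      using True nonneg by (simp add: scaled_exponent_def lookup_floor_exponent)
    show ?thesis
      unfolding eq
    proof (rule tendsto_sandwich[where f = "\<lambda>n. \<alpha> j - 1 / real n" and h = "\<lambda>_. \<alpha> j"])
      show "\<forall>\<^sub>F n in sequentially. \<alpha> j - 1 / real n \<le> of_int \<lfloor>real n * \<alpha> j\<rfloor> / real n"
        using eventually_gt_at_top[of 0]
      proof eventually_elim
        case (elim n)
        have "real n * \<alpha> j - 1 \<le> of_int \<lfloor>real n * \<alpha> j\<rfloor>"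
          by linarith
        then have "(real n * \<alpha> j - 1) / real n \<le> of_int \<lfloor>real n * \<alpha> j\<rfloor> / real n"
          by (rule divide_right_mono) simp
        then show ?case
          using elim by (simp add: diff_divide_distrib)
      qed
      show "\<forall>\<^sub>F n in sequentially. of_int \<lfloor>real n * \<alpha> j\<rfloor> / real n \<le> \<alpha> j"
        using eventually_gt_at_top[of 0]
        by eventually_elim (simp add: divide_le_eq mult.commute)
      show "(\<lambda>n. \<alpha> j - 1 / real n) \<longlonglongrightarrow> \<alpha> j"
        using tendsto_diff[OF tendsto_const lim_1_over_n, of "\<alpha> j"] by simp
    qed simp
  next
    case False
    then show ?thesis
      using assms by (simp add: corner_simplex_def scaled_exponent_def lookup_floor_exponent)
  qed
qed

text \<open>
  Moving \<open>\<alpha>\<close> slightly towards the point whose coordinates are all \<open>1 / (d + 1)\<close> makes all inequalities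
  strict.
\<close>

lemma corner_simplex_subset_closure_interior:
  assumes \<alpha>: "\<alpha> \<in> corner_simplex d" and W: "open W" "\<alpha> \<in> W"
  shows "W \<inter> (Euclidean_space d interior_of corner_simplex d) \<noteq> {}"
proof -
  define O' where "O' = (\<Inter>j\<in>{..<d}. {\<alpha> :: nat \<Rightarrow> real. 0 < \<alpha> j}) \<inter> {\<alpha>. (\<Sum>j<d. \<alpha> j) < 1}"
  define V where "V = {\<alpha> :: nat \<Rightarrow> real. \<forall>j\<ge>d. \<alpha> j = 0} \<inter> O'"
  have "open O'"
    unfolding O'_def by (intro open_Int open_INT open_Collect_less ballI continuous_intros) auto
  then have "openin (Euclidean_space d) V"
    unfolding Euclidean_space_eq V_def by (rule openin_open_Int)
  moreover have "V \<subseteq> corner_simplex d"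
    by (auto simp: V_def O'_def corner_simplex_def less_imp_le)
  ultimately have V: "V \<subseteq> Euclidean_space d interior_of corner_simplex d"
    by (intro interior_of_maximal)
  define \<epsilon> where "\<epsilon> n = inverse (real (Suc n))" for n
  define c where "c = inverse (real (Suc d))"
  define a where "a n j = (if j < d then (1 - \<epsilon> n) * \<alpha> j + \<epsilon> n * c else 0)" for n j
  have \<epsilon>: "0 < \<epsilon> n" "\<epsilon> n \<le> 1" for n
    by (simp_all add: \<epsilon>_def inverse_le_1_iff)
  have c: "c > 0" "real d * c < 1"
    by (simp_all add: c_def field_simps)
  have "a n \<in> V" for n
  proof -
    have "a n j > 0" if "j < d" for j
      using that \<alpha> \<epsilon>[of n] c by (simp add: a_def corner_simplex_def add_nonneg_pos)
    moreover have "(\<Sum>j<d. a n j) < 1"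
    proof -
      have "(\<Sum>j<d. a n j) = (1 - \<epsilon> n) * (\<Sum>j<d. \<alpha> j) + \<epsilon> n * (real d * c)"
        by (simp add: a_def sum.distrib sum_distrib_left)
      also have "\<dots> < (1 - \<epsilon> n) * 1 + \<epsilon> n * 1"
        using \<alpha> \<epsilon>[of n] c by (intro add_le_less_mono mult_left_mono mult_strict_left_mono) (auto simp: corner_simplex_def)
      finally show ?thesis by simp
    qed
    ultimately show ?thesis
      by (simp add: V_def O'_def a_def)
  qed
  moreover have "a \<longlonglongrightarrow> \<alpha>"
    unfolding tendsto_fun_iff
  proof
    fix j
    have "(\<lambda>n. (1 - \<epsilon> n) * \<alpha> j + \<epsilon> n * c) \<longlonglongrightarrow> (1 - 0) * \<alpha> j + 0 * c"
      unfolding \<epsilon>_def by (intro tendsto_intros LIMSEQ_inverse_real_of_nat)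
    then show "(\<lambda>n. a n j) \<longlonglongrightarrow> \<alpha> j"
      using \<alpha> by (cases "j < d") (simp_all add: a_def corner_simplex_def)
  qed
  then have "\<forall>\<^sub>F n in sequentially. a n \<in> W"
    using W by (rule topological_tendstoD)
  then obtain n where "a n \<in> W"
    by (meson eventually_sequentially order_refl)
  ultimately show ?thesis
    using V by blast
qed

section \<open>The Okounkov body and the Chebyshev transform\<close>

context adapted_frame begin

definition chebyshev_formula :: "(nat \<Rightarrow> real) \<Rightarrow> real" where
  "chebyshev_formula \<alpha> = (\<Sum>j\<le>d. barycentric d \<alpha> j * ln (1 / gs_coeff j))
    + 1 / 2 * entropy d (barycentric d \<alpha>)"

lemma continuous_on_chebyshev_formula: "continuous_on (corner_simplex d) chebyshev_formula"
proof -
  have "continuous_on (corner_simplex d) (\<lambda>\<alpha>. barycentric d \<alpha> j * ln (1 / barycentric d \<alpha> j))"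
    if "j \<le> d" for j
    by (rule continuous_on_compose2[OF continuous_on_entropy_term continuous_on_barycentric])
       (use that barycentric_nonneg in auto)
  then show ?thesis
    unfolding chebyshev_formula_def[abs_def] entropy_def
    by (intro continuous_on_add continuous_on_sum continuous_on_mult_left
        continuous_on_mult_right continuous_on_barycentric) auto
qed

text \<open>
  In the logarithm of \<open>monomial_norm\<close>, a vanishing entry of \<open>m\<close> contributes \<open>ln 1 = 0\<close>, in accordance
  with the convention for the entropy.
\<close>

lemma ln_lead_sup:
  assumes n: "n > 0" and \<mu>: "\<mu> \<in> parameter_exponents d n"
  shows "1 / real n * ln (lead_sup d x (Y d) param n \<mu>) = chebyshev_formula (scaled_exponent n \<mu>)"
proof -
  define m where "m = homogenize d n \<mu>"
  define \<beta> where "\<beta> = barycentric d (scaled_exponent n \<mu>)"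
  have \<mu>': "keys \<mu> \<subseteq> {..<d}" "(\<Sum>j<d. lookup \<mu> j) \<le> n"
    using \<mu> by (simp_all add: parameter_exponents_def)
  have \<beta>: "\<beta> j = real (lookup m j) / real n" if "j \<le> d" for j
  proof (cases "j = d")
    case True
    have "\<beta> d = 1 - real (\<Sum>j<d. lookup \<mu> j) / real n"
      by (simp add: \<beta>_def barycentric_def scaled_exponent_def sum_divide_distrib)
    also have "\<dots> = real (lookup m d) / real n"
      using n \<mu>' by (simp add: m_def lookup_homogenize_last of_nat_diff diff_divide_distrib)
    finally show ?thesis
      by (simp add: True)
  next
    case False
    then show ?thesis
      using that by (simp add: \<beta>_def barycentric_def scaled_exponent_def m_def)
  qed
  have g: "ln (gs_coeff j ^ lookup m j) = real n * (\<beta> j * - ln (1 / gs_coeff j))" if "j \<le> d" for j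
    using gs_coeff_pos[OF that] n by (simp add: ln_realpow ln_div \<beta>[OF that])
  have v: "ln (sqrt (real (lookup m j) / real n) ^ lookup m j) = real n * (- 1 / 2 * (\<beta> j * ln (1 / \<beta> j)))"
    if "j \<le> d" for j
  proof (cases "lookup m j = 0")
    case True
    then show ?thesis by (simp add: \<beta>[OF that])
  next
    case False
    then have "\<beta> j > 0"
      using n by (simp add: \<beta>[OF that])
    then have "ln (sqrt (\<beta> j) ^ lookup m j) = real (lookup m j) * (ln (\<beta> j) / 2)"
      by (simp add: ln_realpow ln_sqrt)
    also have "\<dots> = real n * (- 1 / 2 * (\<beta> j * ln (1 / \<beta> j)))"
      using n \<open>\<beta> j > 0\<close> by (simp add: ln_div) (simp add: \<beta>[OF that])
    finally show ?thesis
      by (simp add: \<beta>[OF that])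
  qed
  have g_pos: "gs_coeff j ^ lookup m j > 0" if "j \<le> d" for j
    using gs_coeff_pos[OF that] by simp
  have v_pos: "sqrt (real (lookup m j) / real n) ^ lookup m j > 0" for j
    using n by (auto simp: zero_less_power_eq)
  have "ln (lead_sup d x (Y d) param n \<mu>)
      = - (ln (\<Prod>j\<le>d. gs_coeff j ^ lookup m j) + ln (monomial_norm d n m))"
  proof -
    have "ln (1 / (G * V)) = - (ln G + ln V)" if "G > 0" "V > 0" for G V :: real
      using that by (simp add: ln_div ln_mult)
    moreover have "(\<Prod>j\<le>d. gs_coeff j ^ lookup m j) > 0"
      using gs_coeff_pos by (intro prod_pos) auto
    ultimately show ?thesis
      unfolding lead_sup_eq[OF n \<mu>] m_def[symmetric] using monomial_norm_pos[OF n] by blast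
  qed
  also have "ln (\<Prod>j\<le>d. gs_coeff j ^ lookup m j) = (\<Sum>j\<le>d. ln (gs_coeff j ^ lookup m j))"
    using g_pos by (intro ln_prod finite_atMost) (metis atMost_iff less_irrefl)
  also have "\<dots> = (\<Sum>j\<le>d. real n * (\<beta> j * - ln (1 / gs_coeff j)))"
    by (intro sum.cong refl g) simp
  also have "ln (monomial_norm d n m) = (\<Sum>j\<le>d. ln (sqrt (real (lookup m j) / real n) ^ lookup m j))"
    unfolding monomial_norm_def using v_pos by (intro ln_prod finite_atMost) (metis less_irrefl)
  also have "\<dots> = (\<Sum>j\<le>d. real n * (- 1 / 2 * (\<beta> j * ln (1 / \<beta> j))))"
    by (intro sum.cong refl v) simp
  finally have "ln (lead_sup d x (Y d) param n \<mu>)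
      = real n * ((\<Sum>j\<le>d. \<beta> j * ln (1 / gs_coeff j)) + 1 / 2 * (\<Sum>j\<le>d. \<beta> j * ln (1 / \<beta> j)))"
    by (simp only: sum_distrib_left[symmetric] mult_minus_right sum_negf) (simp add: algebra_simps)
  then show ?thesis
    using n by (simp add: chebyshev_formula_def entropy_def \<beta>_def)
qed

lemma okounkov_body_eq: "okounkov_body d x (Y d) param = corner_simplex d"
  unfolding okounkov_body_def ord_set_eq
proof (rule equalityI)
  have "(\<Union>n\<in>{1..}. scaled_exponent n ` parameter_exponents d n) \<subseteq> corner_simplex d"
    using scaled_exponent_in_corner_simplex by blast
  moreover have "closedin (Euclidean_space d) (corner_simplex d)"
    unfolding closedin_Euclidean_space_iff topspace_Euclidean_space
    using closed_corner_simplex by (auto simp: corner_simplex_def)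
  ultimately show "Euclidean_space d closure_of
      (\<Union>n\<in>{1..}. scaled_exponent n ` parameter_exponents d n) \<subseteq> corner_simplex d"
    by (rule closure_of_minimal)
  show "corner_simplex d \<subseteq> Euclidean_space d closure_of
      (\<Union>n\<in>{1..}. scaled_exponent n ` parameter_exponents d n)"
  proof
    fix \<alpha> assume \<alpha>: "\<alpha> \<in> corner_simplex d"
    have "\<exists>\<beta>. \<beta> \<in> (\<Union>n\<in>{1..}. scaled_exponent n ` parameter_exponents d n) \<and> \<beta> \<in> T"
      if T: "\<alpha> \<in> T" "openin (Euclidean_space d) T" for T
    proof -
      obtain W where W: "open W" "T = {\<alpha>. \<forall>j\<ge>d. \<alpha> j = 0} \<inter> W"
        using T(2) unfolding Euclidean_space_eq openin_open by blast
      have "\<forall>\<^sub>F n in sequentially. scaled_exponent n (floor_exponent d \<alpha> n) \<in> W"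
        using scaled_floor_exponent_tendsto[OF \<alpha>] W T(1) by (auto intro: topological_tendstoD)
      from eventually_happens'[OF sequentially_bot eventually_conj[OF eventually_ge_at_top[of 1] this]]
      obtain n where n: "n \<ge> 1" "scaled_exponent n (floor_exponent d \<alpha> n) \<in> W"
        by blast
      have "floor_exponent d \<alpha> n \<in> parameter_exponents d n"
        using \<alpha> by (rule floor_exponent_in_parameter_exponents)
      then show ?thesis
        using n scaled_exponent_in_corner_simplex[of "floor_exponent d \<alpha> n" d n] unfolding W(2)
        by (intro exI[of _ "scaled_exponent n (floor_exponent d \<alpha> n)"]) (auto simp: corner_simplex_def)
    qed
    moreover have "\<alpha> \<in> topspace (Euclidean_space d)"
      using \<alpha> by (simp add: topspace_Euclidean_space corner_simplex_def)
    ultimately show "\<alpha> \<in> Euclidean_space d closure_of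
        (\<Union>n\<in>{1..}. scaled_exponent n ` parameter_exponents d n)"
      by (auto simp only: in_closure_of)
  qed
qed

lemma chebyshev_limit_formula:
  assumes "\<alpha> \<in> corner_simplex d"
  shows "chebyshev_limit d x (Y d) param \<alpha> (chebyshev_formula \<alpha>)"
  unfolding chebyshev_limit_def ord_set_eq
proof (intro allI impI)
  fix m
  assume m: "\<forall>n\<ge>1. m n \<in> parameter_exponents d n"
    and lim: "(\<lambda>n. scaled_exponent n (m n)) \<longlonglongrightarrow> \<alpha>"
  have pos: "\<forall>\<^sub>F n in sequentially. n \<ge> 1"
    by (rule eventually_ge_at_top)
  then have "\<forall>\<^sub>F n in sequentially. scaled_exponent n (m n) \<in> corner_simplex d"
    by eventually_elim (use m scaled_exponent_in_corner_simplex in auto)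
  with lim assms have "(\<lambda>n. chebyshev_formula (scaled_exponent n (m n))) \<longlonglongrightarrow> chebyshev_formula \<alpha>"
    by (intro continuous_on_tendsto_compose[OF continuous_on_chebyshev_formula])
  moreover have "\<forall>\<^sub>F n in sequentially. chebyshev_formula (scaled_exponent n (m n))
      = 1 / real n * ln (lead_sup d x (Y d) param n (m n))"
    using pos by eventually_elim (use m in \<open>simp add: ln_lead_sup[symmetric]\<close>)
  ultimately show "(\<lambda>n. 1 / real n * ln (lead_sup d x (Y d) param n (m n))) \<longlonglongrightarrow> chebyshev_formula \<alpha>"
    by (rule Lim_transform_eventually)
qed

text \<open>
  The limit is unique because \<open>floor_exponent\<close> provides at least one sequence of orders to which its
  definition applies.
\<close>

lemma the_chebyshev_limit:
  assumes "\<alpha> \<in> corner_simplex d"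
  shows "(THE l. chebyshev_limit d x (Y d) param \<alpha> l) = chebyshev_formula \<alpha>"
proof (rule the_equality)
  show "chebyshev_limit d x (Y d) param \<alpha> (chebyshev_formula \<alpha>)"
    using assms by (rule chebyshev_limit_formula)
  have lim: "(\<lambda>n. 1 / real n * ln (lead_sup d x (Y d) param n (floor_exponent d \<alpha> n))) \<longlonglongrightarrow> l"
    if "chebyshev_limit d x (Y d) param \<alpha> l" for l
    using that floor_exponent_in_parameter_exponents[OF assms] scaled_floor_exponent_tendsto[OF assms]
    by (simp add: chebyshev_limit_def ord_set_eq)
  fix l assume "chebyshev_limit d x (Y d) param \<alpha> l"
  then show "l = chebyshev_formula \<alpha>"
    using LIMSEQ_unique lim chebyshev_limit_formula[OF assms] by blast
qed

text \<open>
  A point of the simplex outside its interior is a limit of interior points, so the limit that defines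
  the continuous extension there is determined, and by continuity it is the value of the formula.
\<close>

lemma chebyshev_eq:
  assumes \<alpha>: "\<alpha> \<in> corner_simplex d"
  shows "chebyshev d x (Y d) param \<alpha> = chebyshev_formula \<alpha>"
proof -
  define I where "I = Euclidean_space d interior_of corner_simplex d"
  define c where "c = (\<lambda>\<beta>. THE l. chebyshev_limit d x (Y d) param \<beta> l)"
  have I: "I \<subseteq> corner_simplex d"
    unfolding I_def by (rule interior_of_subset)
  have c: "c \<beta> = chebyshev_formula \<beta>" if "\<beta> \<in> corner_simplex d" for \<beta>
    using that by (simp add: c_def the_chebyshev_limit)
  have "Lim (at \<alpha> within I) c = chebyshev_formula \<alpha>" if "\<alpha> \<notin> I"
  proof (rule tendsto_Lim)
    have "\<alpha> islimpt I"
    proof (rule islimptI)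
      fix W assume "\<alpha> \<in> W" "open W"
      then obtain \<beta> where "\<beta> \<in> W" "\<beta> \<in> I"
        using corner_simplex_subset_closure_interior[OF \<alpha>] unfolding I_def by blast
      then show "\<exists>\<beta>\<in>I. \<beta> \<in> W \<and> \<beta> \<noteq> \<alpha>"
        using that by blast
    qed
    then show "at \<alpha> within I \<noteq> bot"
      by (simp add: trivial_limit_within)
    have "(chebyshev_formula \<longlongrightarrow> chebyshev_formula \<alpha>) (at \<alpha> within I)"
      using continuous_on_chebyshev_formula \<alpha> I
      by (metis continuous_on_def tendsto_within_subset)
    moreover have "\<forall>\<^sub>F \<beta> in at \<alpha> within I. chebyshev_formula \<beta> = c \<beta>"
      unfolding eventually_at_filter using c I by (intro always_eventually) auto
    ultimately show "(c \<longlongrightarrow> chebyshev_formula \<alpha>) (at \<alpha> within I)"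
      by (rule Lim_transform_eventually)
  qed
  then show ?thesis
    using c[OF \<alpha>] by (simp add: chebyshev_def okounkov_body_eq I_def c_def Let_def)
qed

end

theorem proposition5p4p1:
  fixes d :: nat
    and x :: "nat \<Rightarrow> complex"
    and Y U :: "nat \<Rightarrow> mpol"
    and t :: "nat \<Rightarrow> (nat \<Rightarrow> complex) \<Rightarrow> complex"
    and \<sigma> :: mpol
    and \<gamma> :: "nat \<Rightarrow> real"
  assumes d: "d \<ge> 1"
    and x: "x \<in> proj_coords d"
    and inj: "inj_on Y {..d}"
    and indep: "mpol.independent (Y ` {..d})"
    and basis: "mpol.span (Y ` {..d}) = sections d 1"
    and vanishing: "mpol.span (Y ` {..<d}) = {p \<in> sections d 1. peval p x = 0}"
    and t: "t = (\<lambda>j y. peval (Y j) y / peval (Y d) y)"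
    and \<sigma>: "\<sigma> = Y d"
    and U: "U = gram_schmidt d Y"
    and \<gamma>: "\<gamma> = (\<lambda>j. Re (inverse (form_inner d (Y j) (U j))))"
  shows "(\<forall>j\<le>d. of_real (\<gamma> j) = inverse (form_inner d (Y j) (U j)) \<and> \<gamma> j > 0) \<and>
    okounkov_body d x \<sigma> t =
      {\<alpha>. (\<forall>j<d. \<alpha> j \<ge> 0) \<and> (\<forall>j\<ge>d. \<alpha> j = 0) \<and> (\<Sum>j<d. \<alpha> j) \<le> 1} \<and>
    (\<forall>\<alpha>\<in>okounkov_body d x \<sigma> t.
      let \<beta> = \<alpha>(d := 1 - (\<Sum>j<d. \<alpha> j))
      in chebyshev d x \<sigma> t \<alpha> = (\<Sum>j\<le>d. \<beta> j * ln (\<gamma> j)) + 1 / 2 * entropy d \<beta>)"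
proof -
  have vanish: "peval (Y j) x = 0" if "j < d" for j
  proof -
    have "Y j \<in> mpol.span (Y ` {..<d})"
      using that by (intro mpol.span_base) simp
    then show ?thesis
      by (simp add: vanishing)
  qed
  interpret frame: adapted_frame d x Y
    using x inj indep basis vanish by unfold_locales
  have U_eq: "U = frame.U"
    by (simp add: U frame.U_def)
  have inner: "inverse (form_inner d (Y j) (U j)) = of_real (1 / frame.gs_coeff j)" if "j \<le> d" for j
    using frame.form_inner_Y_U[OF that] by (simp add: U_eq inverse_eq_divide)
  have \<gamma>_eq: "\<gamma> j = 1 / frame.gs_coeff j" if "j \<le> d" for j
    unfolding \<gamma> inner[OF that] by (rule Re_complex_of_real)
  have part1: "\<forall>j\<le>d. of_real (\<gamma> j) = inverse (form_inner d (Y j) (U j)) \<and> \<gamma> j > 0"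
    using inner \<gamma>_eq frame.gs_coeff_pos by simp
  have body: "okounkov_body d x \<sigma> t = corner_simplex d"
    unfolding \<sigma> t by (rule frame.okounkov_body_eq)
  have "let \<beta> = \<alpha>(d := 1 - (\<Sum>j<d. \<alpha> j))
      in chebyshev d x \<sigma> t \<alpha> = (\<Sum>j\<le>d. \<beta> j * ln (\<gamma> j)) + 1 / 2 * entropy d \<beta>"
    if "\<alpha> \<in> corner_simplex d" for \<alpha>
    unfolding Let_def \<sigma> t frame.chebyshev_eq[OF that] frame.chebyshev_formula_def barycentric_def
    by (simp add: \<gamma>_eq)
  with part1 show ?thesis
    unfolding body by (auto simp: corner_simplex_def)
qed

end
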